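(* For any formula $A$ such that $\dim[\![A]\!]<\infty$, there exist distinct binary sequences $T_1,\dots,T_r\in\{0,1\}^*$ such that $[\![\underline{T_1}_A]\!],\dots,[\![\underline{T_r}_A]\!]$ are linearly dependent in $[\![\mathbf{bint}_A]\!]$.
   Context: $k$ is an algebraically closed field (assumed of characteristic zero). Formulas are those of propositional intuitionistic linear logic with connectives $\otimes,\&,\multimap,!$. The *Sweedler semantics* $[\![-]\!]$: chosen vector spaces for atoms, $[\![A\otimes B]\!]=[\![A]\!]\otimes[\![B]\!]$, $[\![A\&B]\!]=[\![A]\!]\oplus[\![B]\!]$, $[\![A\multimap B]\!]=\mathrm{Hom}_k([\![A]\!],[\![B]\!])$, $[\![!A]\!]={!}[\![A]\!]$, where $!V$ is the universal (cofree) cocommutative coassociative counital coalgebra with universal linear map $d:{!}V\to V$. Proofs denote linear maps in the standard way: dereliction is $d$, contraction is comultiplication, weakening is the counit, promotion is the unique lift to a coalgebra morphism, cut is composition; a proof of $\vdash B$ denotes an element of $[\![B]\!]$. For finite-dimensional $V$ one has ${!}V=\bigoplus_{P\in V}\mathrm{Sym}_P(V)$ with $\mathrm{Sym}_P(V)=\mathrm{Sym}(V)$; the product $v_1\cdots v_s$ in $\mathrm{Sym}_P(V)$ is written $|v_1,\dots,v_s\rangle_P$ and $1\in\mathrm{Sym}_P(V)$ is $|\emptyset\rangle_P$; $\Delta|v_1,\dots,v_s\rangle_P=\sum_{I\subseteq\{1,\dots,s\}}|v_I\rangle_P\otimes|v_{I^c}\rangle_P$; the counit sends $|\emptyset\rangle_P$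 to $1$ and longer kets to $0$; $d|\emptyset\rangle_P=P$, $d|v\rangle_P=v$, and $d$ vanishes on kets of length $>1$. With $E=A\multimap A$, $\mathbf{bint}_A={!}E\multimap({!}E\multimap E)$. For $T=t_1\cdots t_l\in\{0,1\}^*$, the binary integer $\underline{T}_A$ is the proof of $\mathbf{bint}_A$ given by the term $\lambda!u_0.\lambda!u_1.\lambda a.\,u_{t_l}(\cdots u_{t_1}(a)\cdots)$ (each occurrence derelicted, occurrences of each $u_i$ contracted together, weakening if there are none). Its denotation is regarded as a linear map ${!}V\otimes{!}V\to V$, $V=\mathrm{End}_k([\![A]\!])$, sending $|\emptyset\rangle_{\alpha_0}\otimes|\emptyset\rangle_{\alpha_1}$ to $\alpha_{t_l}\circ\cdots\circ\alpha_{t_1}$. *)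

theory Defs
  imports
    "HOL-Computational_Algebra.Polynomial"
    "HOL-Library.Product_Plus"
begin

section \<open>Linear algebra on subspaces\<close>

definition linear_on ::
  "('k \<Rightarrow> 'u::plus \<Rightarrow> 'u) \<Rightarrow> 'u set \<Rightarrow> ('k \<Rightarrow> 'w::plus \<Rightarrow> 'w) \<Rightarrow> 'w set \<Rightarrow> ('u \<Rightarrow> 'w) \<Rightarrow> bool"
where
  "linear_on s U t W f \<longleftrightarrow>
     (\<forall>x\<in>U. f x \<in> W) \<and>
     (\<forall>x\<in>U. \<forall>y\<in>U. f (x + y) = f x + f y) \<and>
     (\<forall>a. \<forall>x\<in>U. f (s a x) = t a (f x))"

definition bilinear_on ::
  "('k \<Rightarrow> 'u::plus \<Rightarrow> 'u) \<Rightarrow> 'u set \<Rightarrow> 'u set \<Rightarrow> ('k \<Rightarrow> 'w::plus \<Rightarrow> 'w) \<Rightarrow> 'w set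
    \<Rightarrow> ('u \<Rightarrow> 'u \<Rightarrow> 'w) \<Rightarrow> bool"
where
  "bilinear_on s U V t W f \<longleftrightarrow>
     (\<forall>x\<in>U. linear_on s V t W (f x)) \<and>
     (\<forall>y\<in>V. linear_on s U t W (\<lambda>x. f x y))"

definition trilinear_form_on ::
  "('k::field \<Rightarrow> 'u::plus \<Rightarrow> 'u) \<Rightarrow> 'u set \<Rightarrow> ('u \<Rightarrow> 'u \<Rightarrow> 'u \<Rightarrow> 'k) \<Rightarrow> bool"
where
  "trilinear_form_on s U f \<longleftrightarrow>
     (\<forall>x\<in>U. bilinear_on s U U (*) UNIV (f x)) \<and>
     (\<forall>y\<in>U. \<forall>z\<in>U. linear_on s U (*) UNIV (\<lambda>x. f x y z))"

definition finite_dim :: "('k::field \<Rightarrow> 'u::ab_group_add \<Rightarrow> 'u) \<Rightarrow> 'u set \<Rightarrow> bool"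
where
  "finite_dim s U \<longleftrightarrow> (\<exists>B. finite B \<and> module.span s B = U)"

text \<open>Linear dependence in \<open>U\<close> of a \<^emph>\<open>family\<close> (repetitions count as dependent).\<close>

definition lin_dependent_in ::
  "('k::field \<Rightarrow> 'u::ab_group_add \<Rightarrow> 'u) \<Rightarrow> 'u set \<Rightarrow> 'u list \<Rightarrow> bool"
where
  "lin_dependent_in s U vs \<longleftrightarrow>
     set vs \<subseteq> U \<and>
     (\<exists>c :: nat \<Rightarrow> 'k. (\<exists>i<length vs. c i \<noteq> 0) \<and> (\<Sum>i<length vs. s (c i) (vs ! i)) = 0)"

text \<open>
  \<open>T\<close> with the bilinear map \<open>t\<close> is a tensor product of \<open>U\<close> and \<open>V\<close>.  All spaces are subspaces of
  one ambient space \<open>'u\<close>, and so are the test spaces; among them are \<open>T\<close> itself and (unless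
  the ambient space is zero) the ground field, which is enough to characterise the tensor product.
\<close>

definition is_tensor_product ::
  "('k \<Rightarrow> 'u::ab_group_add \<Rightarrow> 'u) \<Rightarrow> 'u set \<Rightarrow> 'u set \<Rightarrow> 'u set \<Rightarrow> ('u \<Rightarrow> 'u \<Rightarrow> 'u) \<Rightarrow> bool"
where
  "is_tensor_product s U V T t \<longleftrightarrow>
     bilinear_on s U V s T t \<and>
     (\<forall>b. bilinear_on s U V s UNIV b \<longrightarrow>
        (\<exists>f. linear_on s T s UNIV f \<and> (\<forall>x\<in>U. \<forall>y\<in>V. f (t x y) = b x y) \<and>
           (\<forall>g. linear_on s T s UNIV g \<and> (\<forall>x\<in>U. \<forall>y\<in>V. g (t x y) = b x y)
              \<longrightarrow> (\<forall>z\<in>T. g z = f z))))"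

definition is_product ::
  "('k \<Rightarrow> 'u::ab_group_add \<Rightarrow> 'u) \<Rightarrow> 'u set \<Rightarrow> 'u set \<Rightarrow> 'u set \<Rightarrow> ('u \<Rightarrow> 'u) \<Rightarrow> ('u \<Rightarrow> 'u) \<Rightarrow> bool"
where
  "is_product s U V P p q \<longleftrightarrow>
     linear_on s P s U p \<and> linear_on s P s V q \<and>
     (\<forall>x\<in>U. \<forall>y\<in>V. \<exists>!z. z \<in> P \<and> p z = x \<and> q z = y)"

text \<open>\<open>H\<close> is the space of linear maps from \<open>U\<close> to \<open>V\<close>, with evaluation \<open>e\<close>.\<close>

definition is_hom_space ::
  "('k \<Rightarrow> 'u::ab_group_add \<Rightarrow> 'u) \<Rightarrow> 'u set \<Rightarrow> 'u set \<Rightarrow> 'u set \<Rightarrow> ('u \<Rightarrow> 'u \<Rightarrow> 'u) \<Rightarrow> bool"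
where
  "is_hom_space s U V H e \<longleftrightarrow>
     bilinear_on s H U s V e \<and>
     (\<forall>h. linear_on s U s V h \<longrightarrow> (\<exists>!f. f \<in> H \<and> (\<forall>x\<in>U. e f x = h x)))"


section \<open>Coalgebras\<close>

text \<open>
  A list \<open>[(a\<^sub>1,b\<^sub>1),\<dots>,(a\<^sub>n,b\<^sub>n)]\<close> of pairs presents the tensor
  \<open>a\<^sub>1 \<otimes> b\<^sub>1 + \<dots> + a\<^sub>n \<otimes> b\<^sub>n\<close> in \<open>C \<otimes> C\<close>.  Over a field two such sums are the same element of
  \<open>C \<otimes> C\<close> iff they agree under every bilinear form.  A comultiplication is thus a map into lists
  that is only meaningful up to \<open>tensor_eq\<close> (it is Sweedler's notation taken literally).  Likewise,
  equality in \<open>C \<otimes> C \<otimes> C\<close> is tested by trilinear forms.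
\<close>

definition tensor_eq ::
  "('k::field \<Rightarrow> 'u::plus \<Rightarrow> 'u) \<Rightarrow> 'u set \<Rightarrow> ('u \<times> 'u) list \<Rightarrow> ('u \<times> 'u) list \<Rightarrow> bool"
where
  "tensor_eq s C xs ys \<longleftrightarrow>
     (\<forall>b. bilinear_on s C C (*) UNIV b \<longrightarrow>
        (\<Sum>(x, y)\<leftarrow>xs. b x y) = (\<Sum>(x, y)\<leftarrow>ys. b x y))"

definition cocommutative_coalgebra ::
  "('k::field \<Rightarrow> 'u::ab_group_add \<Rightarrow> 'u) \<Rightarrow> 'u set \<Rightarrow> ('u \<Rightarrow> ('u \<times> 'u) list) \<Rightarrow> ('u \<Rightarrow> 'k) \<Rightarrow> bool"
where
  "cocommutative_coalgebra s C \<Delta> \<epsilon> \<longleftrightarrow>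
     module.subspace s C \<and>
     \<comment> \<open>the comultiplication is a linear map into \<open>C \<otimes> C\<close>\<close>
     (\<forall>c\<in>C. set (\<Delta> c) \<subseteq> C \<times> C) \<and>
     (\<forall>c\<in>C. \<forall>c'\<in>C. tensor_eq s C (\<Delta> (c + c')) (\<Delta> c @ \<Delta> c')) \<and>
     (\<forall>a. \<forall>c\<in>C. tensor_eq s C (\<Delta> (s a c)) (map (\<lambda>(x, y). (s a x, y)) (\<Delta> c))) \<and>
     \<comment> \<open>coassociativity\<close>
     (\<forall>c\<in>C. \<forall>f. trilinear_form_on s C f \<longrightarrow>
        (\<Sum>(x, y)\<leftarrow>\<Delta> c. \<Sum>(x', x'')\<leftarrow>\<Delta> x. f x' x'' y) =
        (\<Sum>(x, y)\<leftarrow>\<Delta> c. \<Sum>(y', y'')\<leftarrow>\<Delta> y. f x y' y'')) \<and>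
     \<comment> \<open>counit\<close>
     linear_on s C (*) UNIV \<epsilon> \<and>
     (\<forall>c\<in>C. (\<Sum>(x, y)\<leftarrow>\<Delta> c. s (\<epsilon> x) y) = c) \<and>
     (\<forall>c\<in>C. (\<Sum>(x, y)\<leftarrow>\<Delta> c. s (\<epsilon> y) x) = c) \<and>
     \<comment> \<open>cocommutativity\<close>
     (\<forall>c\<in>C. tensor_eq s C (\<Delta> c) (map (\<lambda>(x, y). (y, x)) (\<Delta> c)))"

definition coalgebra_morphism ::
  "('k::field \<Rightarrow> 'u::ab_group_add \<Rightarrow> 'u) \<Rightarrow> 'u set \<Rightarrow> ('u \<Rightarrow> ('u \<times> 'u) list) \<Rightarrow> ('u \<Rightarrow> 'k) \<Rightarrow>
   ('k \<Rightarrow> 'w::ab_group_add \<Rightarrow> 'w) \<Rightarrow> 'w set \<Rightarrow> ('w \<Rightarrow> ('w \<times> 'w) list) \<Rightarrow> ('w \<Rightarrow> 'k) \<Rightarrow>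
   ('u \<Rightarrow> 'w) \<Rightarrow> bool"
where
  "coalgebra_morphism s C \<Delta> \<epsilon> t D \<Delta>' \<epsilon>' \<phi> \<longleftrightarrow>
     linear_on s C t D \<phi> \<and>
     (\<forall>c\<in>C. tensor_eq t D (\<Delta>' (\<phi> c)) (map (\<lambda>(x, y). (\<phi> x, \<phi> y)) (\<Delta> c))) \<and>
     (\<forall>c\<in>C. \<epsilon>' (\<phi> c) = \<epsilon> c)"

definition test_scale ::
  "('k::field \<Rightarrow> 'u::ab_group_add \<Rightarrow> 'u) \<Rightarrow> 'k \<Rightarrow> 'u \<times> 'k poly \<Rightarrow> 'u \<times> 'k poly"
where
  "test_scale s a = (\<lambda>(v, p). (s a v, smult a p))"

text \<open>
  \<open>(C, \<Delta>, \<epsilon>)\<close> with \<open>d\<close> is the cofree cocommutative coalgebra on \<open>V\<close>.  A formula cannot quantify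
  over coalgebras in all types; the test coalgebras are those carried by subspaces of
  \<open>'u \<times> 'k poly\<close>.  These include copies of all coalgebras carried by subspaces of the ambient space
  and of all coalgebras of finite dimension.  As every coalgebra is the directed union of
  its finite-dimensional subcoalgebras, the universal property then holds for coalgebras of any
  type and dimension.
\<close>

definition is_cofree ::
  "('k::field \<Rightarrow> 'u::ab_group_add \<Rightarrow> 'u) \<Rightarrow> 'u set \<Rightarrow>
   'u set \<Rightarrow> ('u \<Rightarrow> ('u \<times> 'u) list) \<Rightarrow> ('u \<Rightarrow> 'k) \<Rightarrow> ('u \<Rightarrow> 'u) \<Rightarrow> bool"
where
  "is_cofree s V C \<Delta> \<epsilon> d \<longleftrightarrow>
     cocommutative_coalgebra s C \<Delta> \<epsilon> \<and> linear_on s C s V d \<and>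
     (\<forall>(D :: ('u \<times> 'k poly) set) \<Delta>' \<epsilon>' \<phi>.
        cocommutative_coalgebra (test_scale s) D \<Delta>' \<epsilon>' \<and> linear_on (test_scale s) D s V \<phi> \<longrightarrow>
        (\<exists>\<Phi>. coalgebra_morphism (test_scale s) D \<Delta>' \<epsilon>' s C \<Delta> \<epsilon> \<Phi> \<and> (\<forall>c\<in>D. d (\<Phi> c) = \<phi> c) \<and>
           (\<forall>\<Psi>. coalgebra_morphism (test_scale s) D \<Delta>' \<epsilon>' s C \<Delta> \<epsilon> \<Psi> \<and> (\<forall>c\<in>D. d (\<Psi> c) = \<phi> c)
              \<longrightarrow> (\<forall>c\<in>D. \<Psi> c = \<Phi> c))))"


section \<open>Formulas and proofs of intuitionistic linear logic\<close>

datatype 'a form =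
    Atom 'a
  | Tensor "'a form" "'a form"
  | With "'a form" "'a form"
  | Lolli "'a form" "'a form"
  | Bang "'a form"

text \<open>
  Sequent calculus derivations, with hypotheses named by natural numbers, so that exchange is
  implicit.  \<open>x\<close>, \<open>y\<close> name hypotheses of the premises that are consumed by a rule, and \<open>z\<close> the
  hypothesis that it introduces in the conclusion.
\<close>

datatype 'a deriv =
    Ax nat "'a form"
  | Cut nat "'a form" "'a deriv" "'a deriv"
  | TensorL nat nat nat "'a form" "'a form" "'a deriv"
  | TensorR "'a form" "'a form" "'a deriv" "'a deriv"
  | WithL1 nat nat "'a form" "'a form" "'a deriv"
  | WithL2 nat nat "'a form" "'a form" "'a deriv"
  | WithR "'a form" "'a form" "'a deriv" "'a deriv"
  | LolliL nat nat "'a form" "'a form" "'a deriv" "'a deriv"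
  | LolliR nat "'a form" "'a form" "'a deriv"
  | Der nat nat "'a form" "'a deriv"
  | Ctr nat nat nat "'a form" "'a deriv"
  | Weak nat "'a form" "'a deriv"
  | Prom "(nat \<times> 'a form) list" "'a form" "'a deriv"

inductive derives :: "(nat \<rightharpoonup> 'a form) \<Rightarrow> 'a deriv \<Rightarrow> 'a form \<Rightarrow> bool"
where
  "derives [x \<mapsto> A] (Ax x A) A"
| "\<lbrakk>derives \<Gamma> p A; derives (\<Delta>(x \<mapsto> A)) q B; x \<notin> dom \<Delta>; dom \<Gamma> \<inter> dom \<Delta> = {}\<rbrakk>
    \<Longrightarrow> derives (\<Gamma> ++ \<Delta>) (Cut x A p q) B"
| "\<lbrakk>derives (\<Gamma>(x \<mapsto> A, y \<mapsto> B)) p C; x \<notin> dom \<Gamma>; y \<notin> dom \<Gamma>; x \<noteq> y; z \<notin> dom \<Gamma>\<rbrakk>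
    \<Longrightarrow> derives (\<Gamma>(z \<mapsto> Tensor A B)) (TensorL x y z A B p) C"
| "\<lbrakk>derives \<Gamma> p A; derives \<Delta> q B; dom \<Gamma> \<inter> dom \<Delta> = {}\<rbrakk>
    \<Longrightarrow> derives (\<Gamma> ++ \<Delta>) (TensorR A B p q) (Tensor A B)"
| "\<lbrakk>derives (\<Gamma>(x \<mapsto> A)) p C; x \<notin> dom \<Gamma>; z \<notin> dom \<Gamma>\<rbrakk>
    \<Longrightarrow> derives (\<Gamma>(z \<mapsto> With A B)) (WithL1 x z A B p) C"
| "\<lbrakk>derives (\<Gamma>(x \<mapsto> B)) p C; x \<notin> dom \<Gamma>; z \<notin> dom \<Gamma>\<rbrakk>
    \<Longrightarrow> derives (\<Gamma>(z \<mapsto> With A B)) (WithL2 x z A B p) C"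
| "\<lbrakk>derives \<Gamma> p A; derives \<Gamma> q B\<rbrakk> \<Longrightarrow> derives \<Gamma> (WithR A B p q) (With A B)"
| "\<lbrakk>derives \<Gamma> p A; derives (\<Delta>(x \<mapsto> B)) q C; x \<notin> dom \<Delta>; dom \<Gamma> \<inter> dom \<Delta> = {};
    z \<notin> dom \<Gamma>; z \<notin> dom \<Delta>\<rbrakk>
    \<Longrightarrow> derives ((\<Gamma> ++ \<Delta>)(z \<mapsto> Lolli A B)) (LolliL x z A B p q) C"
| "\<lbrakk>derives (\<Gamma>(x \<mapsto> A)) p B; x \<notin> dom \<Gamma>\<rbrakk> \<Longrightarrow> derives \<Gamma> (LolliR x A B p) (Lolli A B)"
| "\<lbrakk>derives (\<Gamma>(x \<mapsto> A)) p C; x \<notin> dom \<Gamma>; z \<notin> dom \<Gamma>\<rbrakk>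
    \<Longrightarrow> derives (\<Gamma>(z \<mapsto> Bang A)) (Der x z A p) C"
| "\<lbrakk>derives (\<Gamma>(x \<mapsto> Bang A, y \<mapsto> Bang A)) p C; x \<notin> dom \<Gamma>; y \<notin> dom \<Gamma>; x \<noteq> y; z \<notin> dom \<Gamma>\<rbrakk>
    \<Longrightarrow> derives (\<Gamma>(z \<mapsto> Bang A)) (Ctr x y z A p) C"
| "\<lbrakk>derives \<Gamma> p C; z \<notin> dom \<Gamma>\<rbrakk> \<Longrightarrow> derives (\<Gamma>(z \<mapsto> Bang A)) (Weak z A p) C"
| "\<lbrakk>derives (map_of (map (\<lambda>(x, B). (x, Bang B)) \<Gamma>)) p A; distinct (map fst \<Gamma>)\<rbrakk>
    \<Longrightarrow> derives (map_of (map (\<lambda>(x, B). (x, Bang B)) \<Gamma>)) (Prom \<Gamma> A p) (Bang A)"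


section \<open>Sweedler semantics\<close>

text \<open>
  All denotations are subspaces of one ambient vector space \<open>'v\<close> with scalar multiplication
  \<open>scl\<close>; this is no restriction, since any family of vector spaces embeds in a single one.
\<close>

record ('k, 'v, 'a) model =
  scl :: "'k \<Rightarrow> 'v \<Rightarrow> 'v"
  interp :: "'a form \<Rightarrow> 'v set"
  tens :: "'a form \<Rightarrow> 'a form \<Rightarrow> 'v \<Rightarrow> 'v \<Rightarrow> 'v"
  proj1 :: "'a form \<Rightarrow> 'a form \<Rightarrow> 'v \<Rightarrow> 'v"
  proj2 :: "'a form \<Rightarrow> 'a form \<Rightarrow> 'v \<Rightarrow> 'v"
  app :: "'a form \<Rightarrow> 'a form \<Rightarrow> 'v \<Rightarrow> 'v \<Rightarrow> 'v"
  comult :: "'a form \<Rightarrow> 'v \<Rightarrow> ('v \<times> 'v) list"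
  counit :: "'a form \<Rightarrow> 'v \<Rightarrow> 'k"
  derel :: "'a form \<Rightarrow> 'v \<Rightarrow> 'v"

text \<open>
  \<open>S\<close> is the set of formulas that are interpreted, \<open>UNIV\<close> being allowed.  The reason for it is
  that, already when all atoms denote the zero space, interpreting all formulas at once takes an
  unbounded tower of spaces of linear maps on infinite-dimensional spaces, and HOL does not prove
  that some type is large enough for that; for the subformulas of one formula there always is one.
  The spaces denoted by the atoms are arbitrary.
\<close>

locale sweedler_semantics =
  fixes M :: "('k::{alg_closed_field, field_char_0}, 'v::ab_group_add, 'a) model"
    and S :: "'a form set"
  assumes ambient: "vector_space (scl M)"
    and subspaces: "A \<in> S \<Longrightarrow> module.subspace (scl M) (interp M A)"
    and Tensor_sem: "Tensor A B \<in> S \<Longrightarrow> A \<in> S \<and> B \<in> S \<and>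
      is_tensor_product (scl M) (interp M A) (interp M B) (interp M (Tensor A B)) (tens M A B)"
    and With_sem: "With A B \<in> S \<Longrightarrow> A \<in> S \<and> B \<in> S \<and>
      is_product (scl M) (interp M A) (interp M B) (interp M (With A B)) (proj1 M A B) (proj2 M A B)"
    and Lolli_sem: "Lolli A B \<in> S \<Longrightarrow> A \<in> S \<and> B \<in> S \<and>
      is_hom_space (scl M) (interp M A) (interp M B) (interp M (Lolli A B)) (app M A B)"
    and Bang_sem: "Bang A \<in> S \<Longrightarrow> A \<in> S \<and>
      is_cofree (scl M) (interp M A) (interp M (Bang A)) (comult M A) (counit M A) (derel M A)"

definition tensor_lift ::
  "('k, 'v::ab_group_add, 'a) model \<Rightarrow> 'a form \<Rightarrow> 'a form \<Rightarrow> ('v \<Rightarrow> 'v \<Rightarrow> 'v) \<Rightarrow> 'v \<Rightarrow> 'v"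
where
  "tensor_lift M A B b =
     (SOME f. linear_on (scl M) (interp M (Tensor A B)) (scl M) UNIV f \<and>
        (\<forall>x\<in>interp M A. \<forall>y\<in>interp M B. f (tens M A B x y) = b x y))"

definition pairing ::
  "('k, 'v::ab_group_add, 'a) model \<Rightarrow> 'a form \<Rightarrow> 'a form \<Rightarrow> 'v \<Rightarrow> 'v \<Rightarrow> 'v"
where
  "pairing M A B x y =
     (THE z. z \<in> interp M (With A B) \<and> proj1 M A B z = x \<and> proj2 M A B z = y)"

definition lam ::
  "('k, 'v::ab_group_add, 'a) model \<Rightarrow> 'a form \<Rightarrow> 'a form \<Rightarrow> ('v \<Rightarrow> 'v) \<Rightarrow> 'v"
where
  "lam M A B h = (THE f. f \<in> interp M (Lolli A B) \<and> (\<forall>x\<in>interp M A. app M A B f x = h x))"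

text \<open>
  A context \<open>x\<^sub>1 : A\<^sub>1, \<dots>, x\<^sub>n : A\<^sub>n\<close> denotes the tensor product of the spaces of the \<open>A\<^sub>i\<close>.  A linear
  map out of it is represented by the corresponding multilinear map, viewed as a function of
  environments \<open>\<rho> :: nat \<Rightarrow> 'v\<close>, which assign vectors to the names of hypotheses.

  For a context \<open>!A\<^sub>1, \<dots>, !A\<^sub>n\<close>, \<open>env_comult\<close> is the comultiplication on pure tensors of the
  tensor product coalgebra, and \<open>is_promotion\<close> states that the multilinear map \<open>\<Phi>\<close> corresponds to
  the coalgebra morphism from it to the cofree coalgebra on \<open>A\<close> which lifts \<open>\<phi>\<close>.
\<close>

fun env_comult ::
  "('k, 'v, 'a) model \<Rightarrow> (nat \<times> 'a form) list \<Rightarrow> (nat \<Rightarrow> 'v) \<Rightarrow> ((nat \<Rightarrow> 'v) \<times> (nat \<Rightarrow> 'v)) list"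
where
  "env_comult M [] \<rho> = [(\<rho>, \<rho>)]"
| "env_comult M ((x, A) # \<Gamma>) \<rho> =
     [(\<rho>'(x := a), \<rho>''(x := b)). (\<rho>', \<rho>'') \<leftarrow> env_comult M \<Gamma> \<rho>, (a, b) \<leftarrow> comult M A (\<rho> x)]"

definition is_promotion ::
  "('k::field, 'v::ab_group_add, 'a) model \<Rightarrow> (nat \<times> 'a form) list \<Rightarrow> 'a form \<Rightarrow>
   ((nat \<Rightarrow> 'v) \<Rightarrow> 'v) \<Rightarrow> ((nat \<Rightarrow> 'v) \<Rightarrow> 'v) \<Rightarrow> bool"
where
  "is_promotion M \<Gamma> A \<phi> \<Phi> \<longleftrightarrow>
     (\<forall>\<rho>. (\<forall>(x, B)\<in>set \<Gamma>. \<rho> x \<in> interp M (Bang B)) \<longrightarrow>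
        (\<forall>(x, B)\<in>set \<Gamma>.
           linear_on (scl M) (interp M (Bang B)) (scl M) (interp M (Bang A)) (\<lambda>v. \<Phi> (\<rho>(x := v)))) \<and>
        \<Phi> \<rho> \<in> interp M (Bang A) \<and>
        tensor_eq (scl M) (interp M (Bang A)) (comult M A (\<Phi> \<rho>))
          (map (\<lambda>(\<rho>', \<rho>''). (\<Phi> \<rho>', \<Phi> \<rho>'')) (env_comult M \<Gamma> \<rho>)) \<and>
        counit M A (\<Phi> \<rho>) = (\<Prod>(x, B)\<leftarrow>\<Gamma>. counit M B (\<rho> x)) \<and>
        derel M A (\<Phi> \<rho>) = \<phi> \<rho>)"

primrec sem ::
  "('k::field, 'v::ab_group_add, 'a) model \<Rightarrow> 'a deriv \<Rightarrow> (nat \<Rightarrow> 'v) \<Rightarrow> 'v"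
where
  "sem M (Ax x A) = (\<lambda>\<rho>. \<rho> x)"
| "sem M (Cut x A p q) = (\<lambda>\<rho>. sem M q (\<rho>(x := sem M p \<rho>)))"
| "sem M (TensorL x y z A B p) =
     (\<lambda>\<rho>. tensor_lift M A B (\<lambda>a b. sem M p (\<rho>(x := a, y := b))) (\<rho> z))"
| "sem M (TensorR A B p q) = (\<lambda>\<rho>. tens M A B (sem M p \<rho>) (sem M q \<rho>))"
| "sem M (WithL1 x z A B p) = (\<lambda>\<rho>. sem M p (\<rho>(x := proj1 M A B (\<rho> z))))"
| "sem M (WithL2 x z A B p) = (\<lambda>\<rho>. sem M p (\<rho>(x := proj2 M A B (\<rho> z))))"
| "sem M (WithR A B p q) = (\<lambda>\<rho>. pairing M A B (sem M p \<rho>) (sem M q \<rho>))"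
| "sem M (LolliL x z A B p q) = (\<lambda>\<rho>. sem M q (\<rho>(x := app M A B (\<rho> z) (sem M p \<rho>))))"
| "sem M (LolliR x A B p) = (\<lambda>\<rho>. lam M A B (\<lambda>a. sem M p (\<rho>(x := a))))"
| "sem M (Der x z A p) = (\<lambda>\<rho>. sem M p (\<rho>(x := derel M A (\<rho> z))))"
| "sem M (Ctr x y z A p) = (\<lambda>\<rho>. \<Sum>(a, b)\<leftarrow>comult M A (\<rho> z). sem M p (\<rho>(x := a, y := b)))"
| "sem M (Weak z A p) = (\<lambda>\<rho>. scl M (counit M A (\<rho> z)) (sem M p \<rho>))"
| "sem M (Prom \<Gamma> A p) = (SOME \<Phi>. is_promotion M \<Gamma> A (sem M p) \<Phi>)"

text \<open>For a proof without hypotheses the environment is irrelevant.\<close>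

definition denotation :: "('k::field, 'v::ab_group_add, 'a) model \<Rightarrow> 'a deriv \<Rightarrow> 'v"
where
  "denotation M p = sem M p (\<lambda>_. 0)"


section \<open>Binary integers\<close>

definition bint :: "'a form \<Rightarrow> 'a form"
where
  "bint A = Lolli (Bang (Lolli A A)) (Lolli (Bang (Lolli A A)) (Lolli A A))"

text \<open>
  A word \<open>t\<^sub>1 \<dots> t\<^sub>l\<close> is a list of booleans, \<open>False\<close> standing for 0 and \<open>True\<close> for 1.  The names
  0 and 1 are \<open>u\<^sub>0\<close> and \<open>u\<^sub>1\<close>, 2 is \<open>a\<close>, 3 is used for intermediate results, and \<open>4 + i\<close> for the
  occurrence of \<open>u\<^sub>0\<close> or \<open>u\<^sub>1\<close> that is due to the letter at the (zero-based) position \<open>i\<close>.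
  \<open>apply_all A n\<close> is the proof of \<open>a : A, f\<^sub>1 : A \<multimap> A, \<dots>, f\<^sub>n : A \<multimap> A \<turnstile> A\<close> with term
  \<open>f\<^sub>n (\<dots> (f\<^sub>1 a) \<dots>)\<close>.
\<close>

fun apply_all :: "'a form \<Rightarrow> nat \<Rightarrow> 'a deriv"
where
  "apply_all A 0 = Ax 2 A"
| "apply_all A (Suc n) = LolliL 3 (4 + n) A A (apply_all A n) (Ax 3 A)"

text \<open>
  \<open>collect E z xs p\<close> derelicts the hypotheses \<open>xs\<close> of type \<open>E\<close> and contracts them to a single
  hypothesis \<open>z\<close> of type \<open>!E\<close>, which is introduced by weakening if \<open>xs\<close> is empty.
\<close>

fun collect :: "'a form \<Rightarrow> nat \<Rightarrow> nat list \<Rightarrow> 'a deriv \<Rightarrow> 'a deriv"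
where
  "collect E z [] p = Weak z E p"
| "collect E z [x] p = Der x z E p"
| "collect E z (x # y # xs) p = Ctr x z z E (collect E z (y # xs) (Der x x E p))"

definition occurrences :: "bool \<Rightarrow> bool list \<Rightarrow> nat list"
where
  "occurrences b T = map (\<lambda>i. 4 + i) (filter (\<lambda>i. T ! i = b) [0..<length T])"

definition binint :: "'a form \<Rightarrow> bool list \<Rightarrow> 'a deriv"
where
  "binint A T =
     (let E = Lolli A A in
      LolliR 0 (Bang E) (Lolli (Bang E) E)
        (LolliR 1 (Bang E) E
          (collect E 0 (occurrences False T)
            (collect E 1 (occurrences True T)
              (LolliR 2 A A (apply_all A (length T)))))))"

lemma derives_apply_all:
  "derives (\<lambda>i. if i = 2 then Some A else if i \<in> {4..<4 + n} then Some (Lolli A A) else None)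
     (apply_all A n) A"
proof (induction n)
  case 0
  have "(\<lambda>i::nat. if i = 2 then Some A else if i \<in> {4..<4 + 0} then Some (Lolli A A) else None) = [2 \<mapsto> A]"
    by (auto simp: fun_eq_iff)
  then show ?case
    using derives.intros(1)[of 2 A] by simp
next
  case (Suc n)
  define \<Gamma> where "\<Gamma> = (\<lambda>i. if i = 2 then Some A else if i \<in> {4..<4 + n} then Some (Lolli A A) else None)"
  have "derives ((\<Gamma> ++ Map.empty)(4 + n \<mapsto> Lolli A A)) (LolliL 3 (4 + n) A A (apply_all A n) (Ax 3 A)) A"
    by (rule derives.intros(8)) (use Suc derives.intros(1)[of 3 A] in \<open>auto simp: \<Gamma>_def dom_def\<close>)
  moreover have "(\<Gamma> ++ Map.empty)(4 + n \<mapsto> Lolli A A) =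
    (\<lambda>i. if i = 2 then Some A else if i \<in> {4..<4 + Suc n} then Some (Lolli A A) else None)"
    by (auto simp: \<Gamma>_def fun_eq_iff)
  ultimately show ?case by simp
qed

lemma derives_collect:
  assumes "derives (\<Gamma> ++ (\<lambda>i. if i \<in> set xs then Some E else None)) p C"
    and "distinct xs" "dom \<Gamma> \<inter> set xs = {}" "z \<notin> dom \<Gamma>" "z \<notin> set xs"
  shows "derives (\<Gamma>(z \<mapsto> Bang E)) (collect E z xs p) C"
  using assms
proof (induction E z xs p arbitrary: \<Gamma> rule: collect.induct)
  case (1 E z p)
  have "\<Gamma> ++ (\<lambda>i. if i \<in> set [] then Some E else None) = \<Gamma>"
    by (auto simp: fun_eq_iff map_add_def)
  with 1 have "derives \<Gamma> p C" "z \<notin> dom \<Gamma>"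
    by simp_all
  then show ?case
    unfolding collect.simps by (rule derives.intros(12))
next
  case (2 E z x p)
  have "\<Gamma> ++ (\<lambda>i. if i \<in> set [x] then Some E else None) = \<Gamma>(x \<mapsto> E)"
    by (auto simp: fun_eq_iff map_add_def)
  with "2.prems"(1) have "derives (\<Gamma>(x \<mapsto> E)) p C"
    by (simp only:)
  moreover have "x \<notin> dom \<Gamma>" "z \<notin> dom \<Gamma>"
    using "2.prems" by auto
  ultimately show ?case
    unfolding collect.simps by (rule derives.intros(10))
next
  case (3 E z x y xs p)
  let ?\<Delta> = "\<Gamma> ++ (\<lambda>i. if i \<in> set (y # xs) then Some E else None)"
  have "\<Gamma> ++ (\<lambda>i. if i \<in> set (x # y # xs) then Some E else None) = ?\<Delta>(x \<mapsto> E)"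
    by (auto simp: fun_eq_iff map_add_def)
  with "3.prems"(1) have "derives (?\<Delta>(x \<mapsto> E)) p C"
    by (simp only:)
  moreover have "x \<notin> dom ?\<Delta>"
    using "3.prems" by (auto split: if_splits)
  ultimately have "derives (?\<Delta>(x \<mapsto> Bang E)) (Der x x E p) C"
    by (intro derives.intros(10))
  moreover have "?\<Delta>(x \<mapsto> Bang E) = \<Gamma>(x \<mapsto> Bang E) ++ (\<lambda>i. if i \<in> set (y # xs) then Some E else None)"
    using "3.prems" by (auto simp: fun_eq_iff map_add_def)
  ultimately have "derives (\<Gamma>(x \<mapsto> Bang E) ++ (\<lambda>i. if i \<in> set (y # xs) then Some E else None))
      (Der x x E p) C"
    by (simp only:)
  then have "derives (\<Gamma>(x \<mapsto> Bang E, z \<mapsto> Bang E)) (collect E z (y # xs) (Der x x E p)) C"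
  proof (rule "3.IH")
    have "dom (\<Gamma>(x \<mapsto> Bang E)) = insert x (dom \<Gamma>)"
      by simp
    then show "dom (\<Gamma>(x \<mapsto> Bang E)) \<inter> set (y # xs) = {}"
      using "3.prems" by auto
  qed (use "3.prems" in auto)
  moreover have "x \<notin> dom \<Gamma>" "x \<noteq> z"
    using "3.prems" by auto
  ultimately show ?case
    unfolding collect.simps using "3.prems"(4) by (intro derives.intros(11))
qed

lemma set_occurrences: "set (occurrences b T) = (\<lambda>i. 4 + i) ` {i. i < length T \<and> T ! i = b}"
  by (auto simp: occurrences_def)

lemma distinct_occurrences: "distinct (occurrences b T)"
  by (auto simp: occurrences_def distinct_map)

theorem derives_binint: "derives Map.empty (binint A T) (bint A)"
proof -
  let ?E = "Lolli A A"
  let ?o = "\<lambda>b i. if i \<in> set (occurrences b T) then Some ?E else None"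
  have "(\<lambda>i. if i = 2 then Some A else if i \<in> {4..<4 + length T} then Some ?E else None)
    = (?o False ++ ?o True)(2 \<mapsto> A)"
    apply (auto simp: fun_eq_iff set_occurrences map_add_def image_iff)
    by (metis add_diff_inverse_nat nat_add_left_cancel_less not_less)+
  then have "derives (?o False ++ ?o True) (LolliR 2 A A (apply_all A (length T))) ?E"
    using derives_apply_all[of A "length T"]
    by (intro derives.intros(9)) (auto simp: set_occurrences map_add_def split: if_splits)
  then have "derives ((?o False)(1 \<mapsto> Bang ?E))
      (collect ?E 1 (occurrences True T) (LolliR 2 A A (apply_all A (length T)))) ?E"
    by (intro derives_collect distinct_occurrences) (auto simp: set_occurrences split: if_splits)
  moreover have "(?o False)(1 \<mapsto> Bang ?E) = [1 \<mapsto> Bang ?E] ++ ?o False"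
    by (auto simp: fun_eq_iff set_occurrences map_add_def)
  ultimately have "derives ([1 \<mapsto> Bang ?E, 0 \<mapsto> Bang ?E]) (collect ?E 0 (occurrences False T)
      (collect ?E 1 (occurrences True T) (LolliR 2 A A (apply_all A (length T))))) ?E"
    by (intro derives_collect distinct_occurrences) (auto simp: set_occurrences split: if_splits)
  then show ?thesis
    unfolding binint_def bint_def Let_def
    by (intro derives.intros(9)) (auto simp: fun_upd_twist)
qed

end

theory Submission
  imports Defs "HOL-Library.FuncSet" "HOL-Library.Multiset"
begin

text \<open>
  Choose a basis of \<open>A\<close>.  The matrix entries of dereliction \<open>!E \<rightarrow> E = End A\<close> are functionals on the
  coalgebra \<open>!E\<close>, so the denotation of a word of length \<open>L\<close> is a product of \<open>L\<close> generic matrices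
  whose entries lie in the dual algebras of the two copies of \<open>!E\<close>.  Since \<open>!E\<close> is cocommutative, these
  algebras are commutative: the entries of the product are combinations of monomials of degree at
  most \<open>L\<close> in finitely many commuting variables, and there are only polynomially many (in \<open>L\<close>) of
  these, while there are \<open>2\<^sup>L\<close> words.
\<close>

section \<open>Counting: polynomial against exponential growth, monomials of bounded degree\<close>

text \<open>For \<open>L = 2 ^ t\<close> the left side is at most a power of two whose exponent is
  linear in \<open>t\<close>, while the right side has exponent \<open>2 ^ t\<close>.\<close>

lemma polynomial_less_power_of_two: "\<exists>L::nat. a * (L + 1) ^ b < 2 ^ L"
proof -
  \<comment> \<open>\<open>t\<close> is the double of a number \<open>r\<close> so large that the
    linear exponent stays below \<open>(r + 1) * (r + 1)\<close>, and each factor is at most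
    \<open>2 ^ r\<close>.\<close>
  define r where "r = 2 * b + a"
  define t where "t = 2 * r"
  have "(t + 1) * b + a < (r + 1) * (r + 1)"
    by (simp add: t_def r_def algebra_simps)
  also have "\<dots> \<le> 2 ^ r * 2 ^ r"
    by (intro mult_mono) (simp_all add: Suc_leI)
  also have "\<dots> = 2 ^ t"
    by (simp add: t_def mult_2 power_add)
  finally have t: "(t + 1) * b + a < 2 ^ t" .
  have "a * (2 ^ t + 1) ^ b \<le> 2 ^ a * (2 ^ (t + 1)) ^ b"
    by (intro mult_mono power_mono) (simp_all add: less_imp_le)
  also have "\<dots> = 2 ^ ((t + 1) * b + a)"
    by (simp only: power_mult[symmetric] power_add[symmetric] add.commute)
  also have "\<dots> < (2::nat) ^ 2 ^ t"
    using t by (intro power_strict_increasing) auto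
  finally show ?thesis by blast
qed

text \<open>These multisets are the monomials of degree at most \<open>n\<close> in the variables
  \<open>X\<close>. Each is determined by its exponents on \<open>X\<close>, which lie between 0 and
  \<open>n\<close>. The crude bound suffices because \<open>card X\<close> will not depend on the
  length of the words.\<close>

lemma multisets_size_le:
  assumes "finite X"
  shows "finite {\<mu>. set_mset \<mu> \<subseteq> X \<and> size \<mu> \<le> n}"
    and "card {\<mu>. set_mset \<mu> \<subseteq> X \<and> size \<mu> \<le> n} \<le> (n + 1) ^ card X"
proof -
  let ?K = "{\<mu>. set_mset \<mu> \<subseteq> X \<and> size \<mu> \<le> n}"
  let ?r = "\<lambda>\<mu>. restrict (count \<mu>) X"
  have inj: "inj_on ?r ?K"
  proof (rule inj_onI, rule multiset_eqI)
    fix \<mu> \<nu> x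
    assume "\<mu> \<in> ?K" "\<nu> \<in> ?K" and eq: "?r \<mu> = ?r \<nu>"
    then have "count \<mu> x = 0 \<and> count \<nu> x = 0" if "x \<notin> X"
      using that by (auto simp: count_eq_zero_iff)
    with fun_cong[OF eq, of x] show "count \<mu> x = count \<nu> x"
      by (cases "x \<in> X") auto
  qed
  have sub: "?r ` ?K \<subseteq> X \<rightarrow>\<^sub>E {..n}"
    by (auto intro: order_trans[OF count_le_size])
  have fin: "finite (X \<rightarrow>\<^sub>E {..n})"
    using assms by (intro finite_PiE) auto
  show "finite ?K"
    using finite_subset[OF sub fin] inj by (rule finite_imageD)
  have "card ?K = card (?r ` ?K)"
    using inj by (simp add: card_image)
  also have "\<dots> \<le> card (X \<rightarrow>\<^sub>E {..n})"
    using sub fin by (rule card_mono[rotated])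
  finally show "card ?K \<le> (n + 1) ^ card X"
    using assms by (simp add: card_PiE)
qed

lemma prod_list_filter_split:
  fixes g :: "'i \<Rightarrow> 'm::comm_monoid_mult"
  shows "(\<Prod>x\<leftarrow>xs. g x) = (\<Prod>x\<leftarrow>filter P xs. g x) * (\<Prod>x\<leftarrow>filter (\<lambda>x. \<not> P x) xs. g x)"
  by (induction xs) (simp_all add: mult_ac)

text \<open>Scalar factors may be regrouped by letter; the offset 4 is the one by which
  \<open>occurrences\<close> names the letters of a word.\<close>

lemma prod_occurrences:
  fixes g :: "nat \<Rightarrow> 'm::comm_monoid_mult"
  shows "(\<Prod>k<length T. g (4 + k)) =
    (\<Prod>x\<leftarrow>occurrences True T. g x) * (\<Prod>x\<leftarrow>occurrences False T. g x)"
proof -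
  have "(\<Prod>k<length T. g (4 + k)) = (\<Prod>k\<leftarrow>[0..<length T]. g (4 + k))"
    by (simp add: prod.distinct_set_conv_list[symmetric] atLeast0LessThan)
  also have "\<dots> = (\<Prod>x\<leftarrow>occurrences True T. g x) * (\<Prod>x\<leftarrow>occurrences False T. g x)"
    by (subst prod_list_filter_split[where P = "\<lambda>i. T ! i"]) (simp add: occurrences_def o_def)
  finally show ?thesis .
qed

section \<open>Linear relations, and linear maps defined on subspaces\<close>

lemma (in vector_space) nontrivial_relation:
  assumes "finite I" "finite F" "card F < card I" "v ` I \<subseteq> span F"
  shows "\<exists>c. (\<exists>i\<in>I. c i \<noteq> 0) \<and> (\<Sum>i\<in>I. scale (c i) (v i)) = 0"
proof (cases "inj_on v I")
  case True
  then have "dependent (v ` I)"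
    using assms independent_span_bound[of F "v ` I"] by (auto simp: card_image)
  then obtain u where "\<exists>w\<in>v ` I. u w \<noteq> 0" "(\<Sum>w\<in>v ` I. scale (u w) w) = 0"
    using assms(1) by (auto simp: dependent_finite)
  with True show ?thesis
    by (intro exI[of _ "u \<circ> v"]) (auto simp: sum.reindex)
next
  case False
  then obtain i j where ij: "i \<in> I" "j \<in> I" "i \<noteq> j" "v i = v j"
    by (auto simp: inj_on_def)
  let ?c = "\<lambda>k. if k = i then 1 else if k = j then - 1 else 0 :: 'a"
  have "(\<Sum>k\<in>I. scale (?c k) (v k)) = (\<Sum>k\<in>{i, j}. scale (?c k) (v k))"
    using assms(1) ij by (intro sum.mono_neutral_right) auto
  also have "\<dots> = 0"
    using ij by simp
  finally show ?thesis
    using ij(1) by (intro exI[of _ ?c]) auto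
qed

text \<open>Linearity is given on \<open>U\<close> only, so the induction has to keep the partial
  sums inside \<open>U\<close>. That \<open>f 0 = 0\<close> follows by scaling with 0, and it
  settles the empty and the infinite index sets.\<close>

lemma linear_on_sum:
  assumes "vector_space s" "vector_space t" "module.subspace s U" "linear_on s U t W f"
    and "\<And>i. i \<in> I \<Longrightarrow> v i \<in> U"
  shows "f (\<Sum>i\<in>I. s (c i) (v i)) = (\<Sum>i\<in>I. t (c i) (f (v i)))"
proof -
  interpret s: vector_space s by fact
  interpret t: vector_space t by fact
  have f0: "f 0 = 0"
    using assms(3,4) by (metis linear_on_def s.scale_zero_left s.subspace_0 t.scale_zero_left)
  show ?thesis
    using assms(5)
  proof (induction I rule: infinite_finite_induct)
    case (insert i I)
    have "(\<Sum>i\<in>I. s (c i) (v i)) \<in> U" "s (c i) (v i) \<in> U"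
      using insert.prems assms(3) by (auto intro!: s.subspace_sum s.subspace_scale)
    then show ?case
      using insert assms(4) by (simp add: linear_on_def)
  qed (simp_all add: f0)
qed

lemma linear_on_sum_list:
  assumes "vector_space s" "vector_space t" "module.subspace s U" "linear_on s U t W f"
    and "\<And>i. i \<in> set is \<Longrightarrow> v i \<in> U"
  shows "f (\<Sum>i\<leftarrow>is. s (c i) (v i)) = (\<Sum>i\<leftarrow>is. t (c i) (f (v i)))"
  using linear_on_sum[OF assms(1-4), of "{..<length is}" "\<lambda>k. v (is ! k)" "\<lambda>k. c (is ! k)"] assms(5)
  by (simp add: sum_list_sum_nth atLeast0LessThan)

lemma vector_space_field: "vector_space ((*) :: 'k::field \<Rightarrow> 'k \<Rightarrow> 'k)"
  by unfold_locales (simp_all add: algebra_simps)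

lemma linear_on_comp:
  assumes "linear_on s U t V f" "linear_on t V r W g"
  shows "linear_on s U r W (g \<circ> f)"
  using assms by (simp add: linear_on_def)

section \<open>The commutative dual algebra of a cocommutative coalgebra\<close>

text \<open>The product of a list of functionals in the dual algebra of a coalgebra.\<close>

primrec convolution ::
  "('u \<Rightarrow> ('u \<times> 'u) list) \<Rightarrow> ('u \<Rightarrow> 'k::field) \<Rightarrow> ('u \<Rightarrow> 'k) list \<Rightarrow> 'u \<Rightarrow> 'k"
where
  "convolution \<Delta> \<epsilon> [] = \<epsilon>"
| "convolution \<Delta> \<epsilon> (f # fs) = (\<lambda>c. \<Sum>(a, b)\<leftarrow>\<Delta> c. f a * convolution \<Delta> \<epsilon> fs b)"

lemma comult_closed:
  assumes "cocommutative_coalgebra s C \<Delta> \<epsilon>" "c \<in> C"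
  shows "set (\<Delta> c) \<subseteq> C \<times> C"
  using assms by (simp add: cocommutative_coalgebra_def)

lemma bilinear_on_mult:
  assumes "linear_on s C (*) UNIV f" "linear_on s C (*) UNIV g"
  shows "bilinear_on s C C (*) (UNIV :: 'k::field set) (\<lambda>a b. f a * g b)"
  using assms by (simp add: bilinear_on_def linear_on_def algebra_simps)

text \<open>Comultiplication is linear only up to \<open>tensor_eq\<close>. The product of two
  linear functionals is a bilinear form, hence does not see the difference.\<close>

lemma linear_on_convolution:
  assumes C: "cocommutative_coalgebra s C \<Delta> \<epsilon>"
    and "\<And>f. f \<in> set fs \<Longrightarrow> linear_on s C (*) UNIV f"
  shows "linear_on s C (*) UNIV (convolution \<Delta> \<epsilon> fs)"
  using assms(2)
proof (induction fs)
  case Nil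
  then show ?case
    using C by (simp add: cocommutative_coalgebra_def)
next
  case (Cons f fs)
  let ?g = "convolution \<Delta> \<epsilon> fs"
  have f: "linear_on s C (*) UNIV f" and g: "linear_on s C (*) UNIV ?g"
    using Cons by simp_all
  have eq: "(\<Sum>(a, b)\<leftarrow>xs. f a * ?g b) = (\<Sum>(a, b)\<leftarrow>ys. f a * ?g b)" if "tensor_eq s C xs ys" for xs ys
    using that bilinear_on_mult[OF f g] by (simp add: tensor_eq_def)
  have add: "tensor_eq s C (\<Delta> (c + c')) (\<Delta> c @ \<Delta> c')" if "c \<in> C" "c' \<in> C" for c c'
    using C that by (simp add: cocommutative_coalgebra_def)
  have scale: "tensor_eq s C (\<Delta> (s k c)) (map (\<lambda>(x, y). (s k x, y)) (\<Delta> c))"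
 if "c \<in> C" for k c
    using C that by (simp add: cocommutative_coalgebra_def)
  have "(\<Sum>(a, b)\<leftarrow>\<Delta> (s k c). f a * ?g b) = k * (\<Sum>(a, b)\<leftarrow>\<Delta> c. f a * ?g b)" if "c \<in> C" for k c
  proof -
    have "(\<Sum>(a, b)\<leftarrow>\<Delta> (s k c). f a * ?g b) = (\<Sum>(a, b)\<leftarrow>\<Delta> c. f (s k a) * ?g b)"
      by (subst eq[OF scale[OF that]]) (simp add: o_def case_prod_unfold)
    also have "\<dots> = (\<Sum>(a, b)\<leftarrow>\<Delta> c. k * (f a * ?g b))"
      using comult_closed[OF C that] f by (intro arg_cong[where f = sum_list] map_cong) (auto simp: linear_on_def)
    finally show ?thesis
      by (simp add: sum_list_const_mult case_prod_unfold)
  qed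
  then show ?case
    by (simp add: linear_on_def eq[OF add])
qed

text \<open>The counit is the unit of the dual algebra: apply \<open>f\<close> to the counit law for
  \<open>c\<close>.\<close>

lemma convolution_single:
  assumes C: "cocommutative_coalgebra s C \<Delta> \<epsilon>" and s: "vector_space s"
    and f: "linear_on s C (*) UNIV f" and c: "c \<in> C"
  shows "convolution \<Delta> \<epsilon> [f] c = f c"
proof -
  have "module.subspace s C" "set (\<Delta> c) \<subseteq> C \<times> C" "(\<Sum>p\<leftarrow>\<Delta> c. s (\<epsilon> (snd p)) (fst p)) = c"
    using C c by (auto simp: cocommutative_coalgebra_def case_prod_unfold)
  then show ?thesis
    using linear_on_sum_list[OF s vector_space_field _ f, of "\<Delta> c" fst "\<lambda>p. \<epsilon> (snd p)"]
    by (force simp: case_prod_unfold mult.commute)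
qed

text \<open>Coassociativity brackets \<open>f\<close> and \<open>g\<close> together, and
  cocommutativity then exchanges them.\<close>

lemma convolution_swap:
  assumes C: "cocommutative_coalgebra s C \<Delta> \<epsilon>"
    and f: "linear_on s C (*) UNIV f" and g: "linear_on s C (*) UNIV g"
    and fs: "\<And>f. f \<in> set fs \<Longrightarrow> linear_on s C (*) UNIV f"
    and c: "c \<in> C"
  shows "convolution \<Delta> \<epsilon> (f # g # fs) c = convolution \<Delta> \<epsilon> (g # f # fs) c"
proof -
  let ?h = "convolution \<Delta> \<epsilon> fs"
  have h: "linear_on s C (*) UNIV ?h"
    using C fs by (rule linear_on_convolution)
  note sub = comult_closed[OF C c]
  \<comment> \<open>Stated for arbitrary \<open>f\<close> and \<open>g\<close>, because it is used
    in both orders.\<close>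
  have assoc: "convolution \<Delta> \<epsilon> (f # g # fs) c =
      (\<Sum>(x, y)\<leftarrow>\<Delta> c. (\<Sum>(x', x'')\<leftarrow>\<Delta> x. f x' * g x'') * ?h y)"
    if f: "linear_on s C (*) UNIV f" and g: "linear_on s C (*) UNIV g" for f g
  proof -
    have "trilinear_form_on s C (\<lambda>x y z. f x * g y * ?h z)"
      using f g h by (simp add: trilinear_form_on_def bilinear_on_def linear_on_def algebra_simps)
    then have "(\<Sum>(x, y)\<leftarrow>\<Delta> c. \<Sum>(x', x'')\<leftarrow>\<Delta> x. f x' * g x'' * ?h y) =
        (\<Sum>(x, y)\<leftarrow>\<Delta> c. \<Sum>(y', y'')\<leftarrow>\<Delta> y. f x * g y' * ?h y'')"
      using C c by (simp add: cocommutative_coalgebra_def)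
    then show ?thesis
      by (simp add: case_prod_unfold mult.assoc sum_list_const_mult flip: sum_list_mult_const)
  qed
  have comm: "(\<Sum>(x', x'')\<leftarrow>\<Delta> x. f x' * g x'') = (\<Sum>(x', x'')\<leftarrow>\<Delta> x. g x' * f x'')" if "x \<in> C" for x
  proof -
    have "tensor_eq s C (\<Delta> x) (map (\<lambda>(x, y). (y, x)) (\<Delta> x))"
      using C that by (simp add: cocommutative_coalgebra_def)
    then show ?thesis
      using bilinear_on_mult[OF f g]
      by (auto simp: tensor_eq_def case_prod_unfold o_def mult.commute)
  qed
  show ?thesis
    unfolding assoc[OF f g] assoc[OF g f]
    using sub comm by (intro arg_cong[where f = sum_list] map_cong) auto
qed

lemma convolution_move_front:
  assumes C: "cocommutative_coalgebra s C \<Delta> \<epsilon>"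
    and "\<And>h. h \<in> set (fs @ f # gs) \<Longrightarrow> linear_on s C (*) UNIV h"
    and "c \<in> C"
  shows "convolution \<Delta> \<epsilon> (fs @ f # gs) c = convolution \<Delta> \<epsilon> (f # fs @ gs) c"
  using assms(2,3)
proof (induction fs arbitrary: c)
  case (Cons g fs)
  have "set (\<Delta> c) \<subseteq> C \<times> C"
    using C Cons.prems(2) by (rule comult_closed)
  then have "convolution \<Delta> \<epsilon> (g # fs @ f # gs) c = convolution \<Delta> \<epsilon> (g # f # fs @ gs) c"
    unfolding convolution.simps(2)[of _ _ g]
    using Cons by (intro arg_cong[where f = sum_list] map_cong) auto
  also have "\<dots> = convolution \<Delta> \<epsilon> (f # g # fs @ gs) c"
    using Cons.prems by (intro convolution_swap[OF C]) auto
  finally show ?case by simp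
qed simp

text \<open>Sorting by moves to the front shows that the product is a monomial, which forgets the
  order of its factors. This is what makes the number of different products grow only
  polynomially.\<close>

lemma convolution_mset:
  assumes C: "cocommutative_coalgebra s C \<Delta> \<epsilon>"
    and "\<And>f. f \<in> set fs \<Longrightarrow> linear_on s C (*) UNIV f"
    and "mset fs = mset gs" "c \<in> C"
  shows "convolution \<Delta> \<epsilon> fs c = convolution \<Delta> \<epsilon> gs c"
  using assms(2-4)
proof (induction fs arbitrary: gs c)
  case (Cons f fs)
  have "f \<in> set gs"
    using Cons.prems(2) by (metis list.set_intros(1) mset_eq_setD)
  then obtain gs1 gs2 where gs: "gs = gs1 @ f # gs2"
    by (auto simp: in_set_conv_decomp)
  then have m: "mset fs = mset (gs1 @ gs2)"
    using Cons.prems(2) by simp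
  have "set (\<Delta> c) \<subseteq> C \<times> C"
    using C Cons.prems(3) by (rule comult_closed)
  then have "convolution \<Delta> \<epsilon> (f # fs) c = convolution \<Delta> \<epsilon> (f # gs1 @ gs2) c"
    unfolding convolution.simps(2)
    using Cons.IH[OF _ m] Cons.prems by (intro arg_cong[where f = sum_list] map_cong) auto
  also have "\<dots> = convolution \<Delta> \<epsilon> gs c"
    unfolding gs using Cons.prems(1,3) mset_eq_setD[OF Cons.prems(2)] gs
    by (intro convolution_move_front[OF C, symmetric]) auto
  finally show ?case .
qed simp


section \<open>Semantics of dereliction, contraction and weakening\<close>

lemma (in vector_space) sum_list_scale_sum:
  "(\<Sum>(a, b)\<leftarrow>xs. \<Sum>i\<in>I. scale (f i a b) (v i)) = (\<Sum>i\<in>I. scale (\<Sum>(a, b)\<leftarrow>xs. f i a b) (v i))"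
  by (induction xs) (auto simp: scale_left_distrib sum.distrib)

text \<open>Dereliction composes each functional with \<open>derel M E\<close>, and contraction
  distributes the argument by comultiplication, so that a pointwise product of functionals turns
  into their convolution at \<open>\<rho> z\<close>. The assumption on \<open>p\<close> leaves the
  value at \<open>z\<close> free, since \<open>collect\<close> overwrites it.\<close>

lemma sem_collect:
  fixes M :: "('k::field, 'v::ab_group_add, 'a) model"
  assumes s: "vector_space (scl M)"
    and C: "cocommutative_coalgebra (scl M) (interp M (Bang E)) (comult M E) (counit M E)"
    and d: "linear_on (scl M) (interp M (Bang E)) (scl M) (interp M E) (derel M E)"
    and "distinct xs" "z \<notin> set xs" "\<rho> z \<in> interp M (Bang E)"
    and "\<And>i x. i \<in> I \<Longrightarrow> x \<in> set xs \<Longrightarrow> linear_on (scl M) (interp M E) (*) UNIV (\<phi> i x)"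
    and "\<And>\<rho>'. \<forall>x. x \<notin> insert z (set xs) \<longrightarrow> \<rho>' x = \<rho> x \<Longrightarrow> \<forall>x\<in>set xs. \<rho>' x \<in> interp M E \<Longrightarrow>
      sem M p \<rho>' = (\<Sum>i\<in>I. scl M (\<Prod>x\<leftarrow>xs. \<phi> i x (\<rho>' x)) (v i))"
  shows "sem M (collect E z xs p) \<rho> =
    (\<Sum>i\<in>I. scl M (convolution (comult M E) (counit M E) (map (\<lambda>x. \<phi> i x \<circ> derel M E) xs) (\<rho> z)) (v i))"
  using C d assms(4-)
proof (induction E z xs p arbitrary: \<rho> v rule: collect.induct)
  case (1 E z p)
  interpret vector_space "scl M" by fact
  \<comment> \<open>Weakening contributes the counit, which is the empty convolution.\<close>
  show ?case
    using "1.prems"(7)[of \<rho>] by (simp add: scale_sum_right)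
next
  case (2 E z x p)
  have "convolution (comult M E) (counit M E) [\<lambda>v. \<phi> i x (derel M E v)] (\<rho> z) = \<phi> i x (derel M E (\<rho> z))"
    if "i \<in> I" for i
    using convolution_single[OF "2.prems"(1) s linear_on_comp[OF "2.prems"(2,6)]] "2.prems"(5) that
    by (simp add: o_def)
  moreover have "derel M E (\<rho> z) \<in> interp M E"
    using "2.prems"(2,5) by (simp add: linear_on_def)
  then have "sem M p (\<rho>(x := derel M E (\<rho> z))) =
      (\<Sum>i\<in>I. scl M (\<phi> i x (derel M E (\<rho> z))) (v i))"
    using "2.prems"(7)[of "\<rho>(x := derel M E (\<rho> z))"] by (simp add: fun_upd_def)
  ultimately show ?case
    by (simp del: convolution.simps add: o_def)
next
  case (3 E z x y xs p)
  interpret vector_space "scl M" by fact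
  let ?d = "derel M E" and ?conv = "convolution (comult M E) (counit M E)"
  let ?xs = "y # xs"
  have "sem M (collect E z ?xs (Der x x E p)) (\<rho>(x := a, z := b)) =
      (\<Sum>i\<in>I. scl M (\<phi> i x (?d a) * ?conv (map (\<lambda>x. \<phi> i x \<circ> ?d) ?xs) b) (v i))"
    if "(a, b) \<in> set (comult M E (\<rho> z))" for a b
  proof -
    have ab: "a \<in> interp M (Bang E)" "b \<in> interp M (Bang E)"
      using comult_closed[OF "3.prems"(1,5)] that by blast+
    have "sem M (collect E z ?xs (Der x x E p)) (\<rho>(x := a, z := b)) =
      (\<Sum>i\<in>I. scl M (?conv (map (\<lambda>x. \<phi> i x \<circ> ?d) ?xs) ((\<rho>(x := a, z := b)) z))
        (scl M (\<phi> i x (?d a)) (v i)))"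
    \<comment> \<open>The factor for \<open>x\<close> is constant while the remaining hypotheses are
      collected, so it is absorbed into the vectors; the induction is over arbitrary
      \<open>v\<close> for this purpose.\<close>
    proof (rule "3.IH"[where \<rho> = "\<rho>(x := a, z := b)" and v = "\<lambda>i. scl M (\<phi> i x (?d a)) (v i)", OF "3.prems"(1,2)])
      fix \<rho>'
      assume \<rho>': "\<forall>u. u \<notin> insert z (set ?xs) \<longrightarrow> \<rho>' u = (\<rho>(x := a, z := b)) u"
        "\<forall>u\<in>set ?xs. \<rho>' u \<in> interp M E"
      \<comment> \<open>The recursive call changes only \<open>z\<close> and the remaining names, so
        \<open>x\<close> still holds the left component \<open>a\<close> when it is
        derelicted.\<close>
      have x: "x \<noteq> z" "x \<notin> set ?xs" "\<rho>' x = a"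
        using "3.prems"(3,4) \<rho>'(1) by auto
      have "sem M (Der x x E p) \<rho>' = sem M p (\<rho>'(x := ?d a))"
        by (simp add: x)
      also have "\<dots> = (\<Sum>i\<in>I. scl M (\<Prod>u\<leftarrow>x # ?xs. \<phi> i u ((\<rho>'(x := ?d a)) u)) (v i))"
      proof (rule "3.prems"(7))
        show "\<forall>u. u \<notin> insert z (set (x # ?xs)) \<longrightarrow> (\<rho>'(x := ?d a)) u = \<rho> u"
          using \<rho>'(1) by auto
        show "\<forall>u\<in>set (x # ?xs). (\<rho>'(x := ?d a)) u \<in> interp M E"
          using \<rho>'(2) ab(1) "3.prems"(2) by (auto simp: linear_on_def)
      qed
      also have "\<And>i. map (\<lambda>u. \<phi> i u ((\<rho>'(x := ?d a)) u)) ?xs = map (\<lambda>u. \<phi> i u (\<rho>' u)) ?xs"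
        using x by auto
      then have "(\<Sum>i\<in>I. scl M (\<Prod>u\<leftarrow>x # ?xs. \<phi> i u ((\<rho>'(x := ?d a)) u)) (v i)) =
          (\<Sum>i\<in>I. scl M (\<Prod>u\<leftarrow>?xs. \<phi> i u (\<rho>' u)) (scl M (\<phi> i x (?d a)) (v i)))"
        by (simp only: list.map(2)[of _ x] prod_list.Cons fun_upd_same) (simp only: scale_scale mult.commute)
      finally show "sem M (Der x x E p) \<rho>' =
        (\<Sum>i\<in>I. scl M (\<Prod>u\<leftarrow>?xs. \<phi> i u (\<rho>' u)) (scl M (\<phi> i x (?d a)) (v i)))" .
    qed (use "3.prems" ab in auto)
    then show ?thesis
      by (simp only: fun_upd_same scale_scale mult.commute)
  qed
  then have "(\<Sum>(a, b)\<leftarrow>comult M E (\<rho> z). sem M (collect E z ?xs (Der x x E p)) (\<rho>(x := a, z := b))) =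
      (\<Sum>(a, b)\<leftarrow>comult M E (\<rho> z). \<Sum>i\<in>I.
        scl M (\<phi> i x (?d a) * ?conv (map (\<lambda>x. \<phi> i x \<circ> ?d) ?xs) b) (v i))"
    by (intro arg_cong[where f = sum_list] map_cong) auto
  also have "\<dots> = (\<Sum>i\<in>I. scl M (\<Sum>(a, b)\<leftarrow>comult M E (\<rho> z).
      \<phi> i x (?d a) * ?conv (map (\<lambda>x. \<phi> i x \<circ> ?d) ?xs) b) (v i))"
    by (rule sum_list_scale_sum)
  finally show ?case
    unfolding collect.simps sem.simps by (simp only: list.map convolution.simps o_def)
qed

section \<open>Abstraction of sums of rank one maps\<close>

text \<open>Linearity is known for \<open>app M A B f\<close>, so uniqueness in the hom space is
  invoked for that map and then transferred to \<open>h\<close>, which agrees with it on the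
  domain.\<close>

lemma lam_eqI:
  assumes "is_hom_space (scl M) (interp M A) (interp M B) (interp M (Lolli A B)) (app M A B)"
    and "f \<in> interp M (Lolli A B)" "\<And>x. x \<in> interp M A \<Longrightarrow> app M A B f x = h x"
  shows "lam M A B h = f"
proof -
  have "linear_on (scl M) (interp M A) (scl M) (interp M B) (app M A B f)"
    using assms(1,2) by (simp add: is_hom_space_def bilinear_on_def)
  then have "\<exists>!g. g \<in> interp M (Lolli A B) \<and> (\<forall>x\<in>interp M A. app M A B g x = app M A B f x)"
    using assms(1) unfolding is_hom_space_def by blast
  then have "(THE g. g \<in> interp M (Lolli A B) \<and> (\<forall>x\<in>interp M A. app M A B g x = app M A B f x)) = f"
    using assms(2) by (intro the1_equality conjI ballI) auto
  then show ?thesis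
    by (simp add: lam_def assms(3) cong: ball_cong)
qed

lemma lam_cong:
  assumes "\<And>x. x \<in> interp M A \<Longrightarrow> h x = h' x"
  shows "lam M A B h = lam M A B h'"
  using assms by (simp add: lam_def cong: ball_cong)

lemma lam_rank_one:
  assumes s: "vector_space (scl M)" and B: "module.subspace (scl M) (interp M B)"
    and hom: "is_hom_space (scl M) (interp M A) (interp M B) (interp M (Lolli A B)) (app M A B)"
    and \<phi>: "linear_on (scl M) (interp M A) (*) UNIV \<phi>" and v: "v \<in> interp M B"
  defines "f \<equiv> lam M A B (\<lambda>x. scl M (\<phi> x) v)"
  shows "f \<in> interp M (Lolli A B)" "x \<in> interp M A \<Longrightarrow> app M A B f x = scl M (\<phi> x) v"
proof -
  interpret vector_space "scl M" by fact
  have "linear_on (scl M) (interp M A) (scl M) (interp M B) (\<lambda>x. scl M (\<phi> x) v)"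
    using \<phi> v B by (simp add: linear_on_def subspace_scale scale_left_distrib)
  then have "\<exists>!f. f \<in> interp M (Lolli A B) \<and> (\<forall>x\<in>interp M A. app M A B f x = scl M (\<phi> x) v)"
    using hom by (simp add: is_hom_space_def)
  from theI'[OF this, folded lam_def, folded f_def]
  show "f \<in> interp M (Lolli A B)" "x \<in> interp M A \<Longrightarrow> app M A B f x = scl M (\<phi> x) v"
    by auto
qed

text \<open>Evaluation is linear in the function, so the sum of the rank one elements behaves like
  \<open>h\<close>, and uniqueness identifies it. This pushes each of the three abstractions of a
  binary integer through a sum over paths.\<close>

lemma lam_sum_rank_one:
  assumes s: "vector_space (scl M)" and B: "module.subspace (scl M) (interp M B)"
    and H: "module.subspace (scl M) (interp M (Lolli A B))"
    and hom: "is_hom_space (scl M) (interp M A) (interp M B) (interp M (Lolli A B)) (app M A B)"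
    and \<phi>: "\<And>i. i \<in> I \<Longrightarrow> linear_on (scl M) (interp M A) (*) UNIV (\<phi> i)"
    and v: "\<And>i. i \<in> I \<Longrightarrow> v i \<in> interp M B"
    and h: "\<And>x. x \<in> interp M A \<Longrightarrow> h x = (\<Sum>i\<in>I. scl M (c i) (scl M (\<phi> i x) (v i)))"
  defines "f \<equiv> \<Sum>i\<in>I. scl M (c i) (lam M A B (\<lambda>x. scl M (\<phi> i x) (v i)))"
  shows "f \<in> interp M (Lolli A B)" "lam M A B h = f"
proof -
  interpret vector_space "scl M" by fact
  note r = lam_rank_one[OF s B hom \<phi> v]
  show f: "f \<in> interp M (Lolli A B)"
    unfolding f_def using r(1) H by (intro subspace_sum subspace_scale)
  show "lam M A B h = f"
  proof (rule lam_eqI[OF hom f])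
    fix x
    assume x: "x \<in> interp M A"
    then have "linear_on (scl M) (interp M (Lolli A B)) (scl M) (interp M B) (\<lambda>f. app M A B f x)"
      using hom by (simp add: is_hom_space_def bilinear_on_def)
    from linear_on_sum[OF s s H this r(1), of I "\<lambda>i. i" "\<lambda>i. i"]
    show "app M A B f x = h x"
      unfolding f_def h[OF x] by (simp add: r(2) x)
  qed
qed

section \<open>Products of matrices as sums over paths of basis vectors\<close>

text \<open>Multiplying by one more matrix extends every path by a last vertex.\<close>

lemma sum_PiE_atMost_Suc:
  "(\<Sum>\<pi>\<in>{..Suc n} \<rightarrow>\<^sub>E B. f \<pi>) = (\<Sum>\<pi>\<in>{..n} \<rightarrow>\<^sub>E B. \<Sum>b\<in>B. f (\<pi>(Suc n := b)))"
proof -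
  have "{..Suc n} \<rightarrow>\<^sub>E B = (\<lambda>(b, \<pi>). \<pi>(Suc n := b)) ` (B \<times> ({..n} \<rightarrow>\<^sub>E B))"
    by (simp add: atMost_Suc PiE_insert_eq)
  then have "(\<Sum>\<pi>\<in>{..Suc n} \<rightarrow>\<^sub>E B. f \<pi>) = (\<Sum>(b, \<pi>)\<in>B \<times> ({..n} \<rightarrow>\<^sub>E B). f (\<pi>(Suc n := b)))"
    using inj_combinator[of "Suc n" "{..n}" "\<lambda>_. B"] by (simp add: sum.reindex case_prod_unfold)
  also have "\<dots> = (\<Sum>b\<in>B. \<Sum>\<pi>\<in>{..n} \<rightarrow>\<^sub>E B. f (\<pi>(Suc n := b)))"
    by (simp add: sum.cartesian_product)
  finally show ?thesis
    by (simp add: sum.swap[of _ B])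
qed

text \<open>The path \<open>\<pi>\<close> picks the basis vectors that occur in one entry of a product of matrices.\<close>

lemma sem_apply_all:
  fixes M :: "('k::field, 'v::ab_group_add, 'a) model"
  assumes s: "vector_space (scl M)"
    and U: "module.subspace (scl M) (interp M A)"
    and hom: "is_hom_space (scl M) (interp M A) (interp M A) (interp M (Lolli A A)) (app M A A)"
    and B: "finite B" "\<not> module.dependent (scl M) B" "module.span (scl M) B = interp M A"
    and "\<rho> 2 \<in> interp M A" "\<And>k. k < n \<Longrightarrow> \<rho> (4 + k) \<in> interp M (Lolli A A)"
  defines "r \<equiv> module.representation (scl M) B"
  shows "sem M (apply_all A n) \<rho> = (\<Sum>\<pi>\<in>{..n} \<rightarrow>\<^sub>E B.
    scl M (\<Prod>k<n. r (app M A A (\<rho> (4 + k)) (\<pi> k)) (\<pi> (Suc k))) (scl M (r (\<rho> 2) (\<pi> 0)) (\<pi> n)))"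
  using assms(8)
proof (induction n)
  case 0
  interpret vector_space "scl M" by fact
  have "(\<Sum>b\<in>B. scl M (r (\<rho> 2) b) b) = \<rho> 2"
    unfolding r_def using assms(7) B by (intro sum_representation_eq) auto
  moreover have "(\<Sum>\<pi>\<in>{..0::nat} \<rightarrow>\<^sub>E B. scl M (r (\<rho> 2) (\<pi> 0)) (\<pi> 0)) =
      (\<Sum>b\<in>B. scl M (r (\<rho> 2) b) b)"
    \<comment> \<open>A path without edges is a single vertex, extended by \<open>undefined\<close>
      as extensionality demands.\<close>
    by (intro sum.reindex_bij_witness[of _ "\<lambda>b. (\<lambda>_. undefined)(0 := b)" "\<lambda>\<pi>. \<pi> 0"])
      (auto simp: PiE_def extensional_def fun_eq_iff)
  ultimately show ?case by simp
next
  case (Suc n)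
  interpret vector_space "scl M" by fact
  let ?f = "\<rho> (4 + n)"
  let ?w = "\<lambda>\<pi>. \<Prod>k<n. r (app M A A (\<rho> (4 + k)) (\<pi> k)) (\<pi> (Suc k))"
  have BU: "B \<subseteq> interp M A"
    using span_superset B(3) by auto
  have f: "linear_on (scl M) (interp M A) (scl M) (interp M A) (app M A A ?f)"
    using hom Suc.prems[of n] by (simp add: is_hom_space_def bilinear_on_def)
  have "sem M (apply_all A (Suc n)) \<rho> = app M A A ?f (sem M (apply_all A n) \<rho>)"
    by simp
  also have "\<dots> = app M A A ?f (\<Sum>\<pi>\<in>{..n} \<rightarrow>\<^sub>E B. scl M (?w \<pi> * r (\<rho> 2) (\<pi> 0)) (\<pi> n))"
    using Suc by simp
  also have "\<dots> = (\<Sum>\<pi>\<in>{..n} \<rightarrow>\<^sub>E B. scl M (?w \<pi> * r (\<rho> 2) (\<pi> 0)) (app M A A ?f (\<pi> n)))"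
    using BU by (intro linear_on_sum[OF s s U f]) auto
  \<comment> \<open>The image of the last vertex is expanded in the basis, and the summation index
    \<open>b\<close> becomes the next vertex.\<close>
  also have "\<dots> = (\<Sum>\<pi>\<in>{..n} \<rightarrow>\<^sub>E B. \<Sum>b\<in>B.
      scl M (?w \<pi> * r (app M A A ?f (\<pi> n)) b) (scl M (r (\<rho> 2) (\<pi> 0)) b))"
  proof (rule sum.cong)
    fix \<pi>
    assume "\<pi> \<in> {..n} \<rightarrow>\<^sub>E B"
    then have "app M A A ?f (\<pi> n) \<in> interp M A"
      using f BU by (auto simp: linear_on_def)
    then have "(\<Sum>b\<in>B. scl M (r (app M A A ?f (\<pi> n)) b) b) = app M A A ?f (\<pi> n)"
      unfolding r_def using B by (intro sum_representation_eq) auto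
    then have "scl M (?w \<pi> * r (\<rho> 2) (\<pi> 0)) (app M A A ?f (\<pi> n)) =
        (\<Sum>b\<in>B. scl M (?w \<pi> * r (\<rho> 2) (\<pi> 0)) (scl M (r (app M A A ?f (\<pi> n)) b) b))"
      by (simp only: scale_sum_right[symmetric])
    then show "scl M (?w \<pi> * r (\<rho> 2) (\<pi> 0)) (app M A A ?f (\<pi> n)) =
        (\<Sum>b\<in>B. scl M (?w \<pi> * r (app M A A ?f (\<pi> n)) b) (scl M (r (\<rho> 2) (\<pi> 0)) b))"
      by (simp add: mult_ac)
  qed simp
  also have "\<dots> = (\<Sum>\<pi>\<in>{..Suc n} \<rightarrow>\<^sub>E B.
      scl M (\<Prod>k<Suc n. r (app M A A (\<rho> (4 + k)) (\<pi> k)) (\<pi> (Suc k)))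
        (scl M (r (\<rho> 2) (\<pi> 0)) (\<pi> (Suc n))))"
    unfolding sum_PiE_atMost_Suc by (intro sum.cong refl) simp
  finally show ?case .
qed


section \<open>Matrix entries and the elements that span the denotations\<close>

text \<open>The first index is the source, that is, the column. With this order, consecutive entries
  along a path share an index.\<close>

definition entry :: "('k::field, 'v::ab_group_add, 'a) model \<Rightarrow> 'a form \<Rightarrow> 'v set \<Rightarrow> 'v \<Rightarrow> 'v \<Rightarrow> 'v \<Rightarrow> 'k"
where
  "entry M A B b b' = (\<lambda>f. module.representation (scl M) B (app M A A f b) b')"

text \<open>For basis vectors, this is the endomorphism taking \<open>b\<close> to \<open>b'\<close>
  and the other basis vectors to 0.\<close>

definition matrix_unit ::
  "('k::field, 'v::ab_group_add, 'a) model \<Rightarrow> 'a form \<Rightarrow> 'v set \<Rightarrow> 'v \<Rightarrow> 'v \<Rightarrow> 'v"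
where
  "matrix_unit M A B b b' = lam M A A (\<lambda>a. scl M (module.representation (scl M) B a b) b')"

text \<open>The element of \<open>!E \<multimap> !E \<multimap> E\<close> given by \<open>x \<otimes> y \<mapsto> (f\<^sub>1 \<cdots> f\<^sub>m)(x) (g\<^sub>1 \<cdots> g\<^sub>n)(y) v\<close>.\<close>

definition rank_one ::
  "('k::field, 'v::ab_group_add, 'a) model \<Rightarrow> 'a form \<Rightarrow> ('v \<Rightarrow> 'k) list \<Rightarrow> ('v \<Rightarrow> 'k) list \<Rightarrow> 'v \<Rightarrow> 'v"
where
  "rank_one M E fs gs v =
     lam M (Bang E) (Lolli (Bang E) E)
       (\<lambda>x. scl M (convolution (comult M E) (counit M E) fs x)
         (lam M (Bang E) E (\<lambda>y. scl M (convolution (comult M E) (counit M E) gs y) v)))"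

lemma rank_one_mset:
  assumes C: "cocommutative_coalgebra (scl M) (interp M (Bang E)) (comult M E) (counit M E)"
    and "\<And>f. f \<in> set fs \<union> set gs \<Longrightarrow> linear_on (scl M) (interp M (Bang E)) (*) UNIV f"
    and "mset fs = mset fs'" "mset gs = mset gs'"
  shows "rank_one M E fs gs v = rank_one M E fs' gs' v"
proof -
  have "convolution (comult M E) (counit M E) fs x = convolution (comult M E) (counit M E) fs' x"
    "convolution (comult M E) (counit M E) gs x = convolution (comult M E) (counit M E) gs' x"
    if "x \<in> interp M (Bang E)" for x
    using that assms(2-4) by (auto intro!: convolution_mset[OF C])
  then show ?thesis
    unfolding rank_one_def by (simp cong: lam_cong)
qed

section \<open>Denotations of binary integers in terms of a basis\<close>

context sweedler_semantics
begin

context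
  fixes A :: "'a form" and B :: "'v set"
  assumes bint: "bint A \<in> S"
    and B: "finite B" "\<not> module.dependent (scl M) B" "module.span (scl M) B = interp M A"
begin

interpretation vector_space "scl M"
  by (rule ambient)

abbreviation (input) "E \<equiv> Lolli A A"

lemma formulas: "A \<in> S" "E \<in> S" "Bang E \<in> S" "Lolli (Bang E) E \<in> S" "bint A \<in> S"
proof -
  show "bint A \<in> S" by (rule bint)
  then show "Bang E \<in> S" "Lolli (Bang E) E \<in> S"
    unfolding bint_def by (blast dest: Lolli_sem)+
  then show "E \<in> S"
    by (blast dest: Lolli_sem)
  then show "A \<in> S"
    by (blast dest: Lolli_sem)
qed

lemma hom:
  "is_hom_space (scl M) (interp M A) (interp M A) (interp M E) (app M A A)"
  "is_hom_space (scl M) (interp M (Bang E)) (interp M E) (interp M (Lolli (Bang E) E)) (app M (Bang E) E)"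
  "is_hom_space (scl M) (interp M (Bang E)) (interp M (Lolli (Bang E) E)) (interp M (bint A))
    (app M (Bang E) (Lolli (Bang E) E))"
  using formulas(2,4,5)[unfolded bint_def, THEN Lolli_sem] by (simp_all add: bint_def)

lemma coalgebra: "cocommutative_coalgebra (scl M) (interp M (Bang E)) (comult M E) (counit M E)"
  and derel: "linear_on (scl M) (interp M (Bang E)) (scl M) (interp M E) (derel M E)"
  using Bang_sem[OF formulas(3)] by (simp_all add: is_cofree_def)

lemma representation_linear:
  "linear_on (scl M) (interp M A) (*) UNIV (\<lambda>a. representation B a b)"
  using B by (auto simp: linear_on_def representation_add representation_scale)

lemma basis_closed: "b \<in> B \<Longrightarrow> b \<in> interp M A"
  using B(3) span_base by blast

lemma entry_linear:
  assumes "b \<in> B"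
  shows "linear_on (scl M) (interp M E) (*) UNIV (entry M A B b b')"
proof -
  have "linear_on (scl M) (interp M E) (scl M) (interp M A) (\<lambda>f. app M A A f b)"
    using hom(1) basis_closed[OF assms] by (simp add: is_hom_space_def bilinear_on_def)
  from linear_on_comp[OF this representation_linear]
  show ?thesis
    by (simp add: entry_def o_def)
qed

lemma matrix_unit_closed: "b' \<in> B \<Longrightarrow> matrix_unit M A B b b' \<in> interp M E"
  unfolding matrix_unit_def
  by (rule lam_rank_one(1)[OF ambient subspaces[OF formulas(1)] hom(1) representation_linear basis_closed])

text \<open>In the path sum only the coordinate at the first vertex depends on the argument
  \<open>a\<close>. Together with the last vertex it abstracts to a matrix unit.\<close>

lemma sem_word:
  assumes "\<And>k. k < n \<Longrightarrow> \<rho> (4 + k) \<in> interp M E"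
  shows "sem M (LolliR 2 A A (apply_all A n)) \<rho> = (\<Sum>\<pi>\<in>{..n} \<rightarrow>\<^sub>E B.
    scl M (\<Prod>k<n. entry M A B (\<pi> k) (\<pi> (Suc k)) (\<rho> (4 + k))) (matrix_unit M A B (\<pi> 0) (\<pi> n)))"
  unfolding sem.simps matrix_unit_def
proof (rule lam_sum_rank_one(2)[OF ambient subspaces[OF formulas(1)] subspaces[OF formulas(2)] hom(1)
      representation_linear basis_closed])
  fix a
  assume "a \<in> interp M A"
  with assms show "sem M (apply_all A n) (\<rho>(2 := a)) = (\<Sum>\<pi>\<in>{..n} \<rightarrow>\<^sub>E B.
      scl M (\<Prod>k<n. entry M A B (\<pi> k) (\<pi> (Suc k)) (\<rho> (4 + k)))
        (scl M (representation B a (\<pi> 0)) (\<pi> n)))"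
    by (subst sem_apply_all[OF ambient subspaces[OF formulas(1)] hom(1) B]) (simp_all add: entry_def)
qed auto

text \<open>Starting from the path sum for the word, \<open>sem_collect\<close> is applied once for
  each letter, and the abstractions over the two arguments then turn every path into one
  \<open>rank_one\<close> element.\<close>

lemma denotation_binint:
  fixes T :: "bool list"
  defines "\<phi> \<equiv> \<lambda>\<pi> x. entry M A B (\<pi> (x - 4)) (\<pi> (x - 3)) \<circ> derel M E"
    and "n \<equiv> length T"
  defines "f \<equiv> \<Sum>\<pi>\<in>{..n} \<rightarrow>\<^sub>E B. rank_one M E (map (\<phi> \<pi>) (occurrences False T))
    (map (\<phi> \<pi>) (occurrences True T)) (matrix_unit M A B (\<pi> 0) (\<pi> n))"
  shows "denotation M (binint A T) = f" "f \<in> interp M (bint A)"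
proof -
  let ?P = "{..n} \<rightarrow>\<^sub>E B"
  let ?u = "\<lambda>\<pi>. matrix_unit M A B (\<pi> 0) (\<pi> n)"
  \<comment> \<open>The hypothesis named \<open>x = 4 + k\<close> is the edge from vertex
    \<open>k = x - 4\<close> to vertex \<open>k + 1 = x - 3\<close>.\<close>
  let ?\<xi> = "\<lambda>\<pi> x. entry M A B (\<pi> (x - 4)) (\<pi> (x - 3))"
  let ?xs = "\<lambda>b. occurrences b T"
  let ?c = "\<lambda>b \<pi>. convolution (comult M E) (counit M E) (map (\<phi> \<pi>) (?xs b))"
  have \<xi>: "linear_on (scl M) (interp M E) (*) UNIV (?\<xi> \<pi> x)"
    if "\<pi> \<in> ?P" "x \<in> set (?xs b)" for \<pi> x b
    using that by (intro entry_linear) (auto simp: set_occurrences n_def)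
  have c: "linear_on (scl M) (interp M (Bang E)) (*) UNIV (?c b \<pi>)" if "\<pi> \<in> ?P" for \<pi> b
    using that \<xi> by (intro linear_on_convolution[OF coalgebra]) (auto simp: \<phi>_def intro: linear_on_comp derel)
  have u: "?u \<pi> \<in> interp M E" if "\<pi> \<in> ?P" for \<pi>
    using that by (intro matrix_unit_closed) auto
  define w where "w = LolliR 2 A A (apply_all A n)"
  have word: "sem M w \<rho> = (\<Sum>\<pi>\<in>?P. scl M (\<Prod>x\<leftarrow>?xs True. ?\<xi> \<pi> x (\<rho> x))
      (scl M (\<Prod>x\<leftarrow>?xs False. ?\<xi> \<pi> x (\<rho> x)) (?u \<pi>)))"
    if "\<forall>b. \<forall>x\<in>set (?xs b). \<rho> x \<in> interp M E" for \<rho>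
  proof -
    have "\<rho> (4 + k) \<in> interp M E" if "k < n" for k
      using that \<open>\<forall>b. _ b\<close> by (auto simp: set_occurrences n_def)
    from sem_word[of n \<rho>, OF this, folded w_def]
    have "sem M w \<rho> = (\<Sum>\<pi>\<in>?P. scl M (\<Prod>k<n. ?\<xi> \<pi> (4 + k) (\<rho> (4 + k))) (?u \<pi>))"
      by simp
    then show ?thesis
      unfolding n_def prod_occurrences[of "\<lambda>x. ?\<xi> _ x (\<rho> x)"] by simp
  qed
  have inner: "sem M (collect E 1 (?xs True) w) \<rho> =
      (\<Sum>\<pi>\<in>?P. scl M (\<Prod>x\<leftarrow>?xs False. ?\<xi> \<pi> x (\<rho> x)) (scl M (?c True \<pi> (\<rho> 1)) (?u \<pi>)))"
    if \<rho>: "\<rho> 1 \<in> interp M (Bang E)" "\<forall>x\<in>set (?xs False). \<rho> x \<in> interp M E" for \<rho>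
  proof -
    have "sem M (collect E 1 (?xs True) w) \<rho> =
        (\<Sum>\<pi>\<in>?P. scl M (?c True \<pi> (\<rho> 1)) (scl M (\<Prod>x\<leftarrow>?xs False. ?\<xi> \<pi> x (\<rho> x)) (?u \<pi>)))"
      unfolding \<phi>_def
    proof (rule sem_collect[where \<phi> = ?\<xi> and \<rho> = \<rho> and z = 1,
          OF ambient coalgebra derel distinct_occurrences _ \<rho>(1) \<xi>[of _ _ True]])
      fix \<rho>'
      assume \<rho>': "\<forall>x. x \<notin> insert 1 (set (?xs True)) \<longrightarrow> \<rho>' x = \<rho> x"
        "\<forall>x\<in>set (?xs True). \<rho>' x \<in> interp M E"
      \<comment> \<open>The names for the letter 0 are untouched here, so their factors are
        constants that belong to the vectors.\<close>
      have eq: "\<rho>' x = \<rho> x" if "x \<in> set (?xs False)" for x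
        using that by (intro \<rho>'(1)[rule_format]) (auto simp: set_occurrences)
      have "\<forall>x\<in>set (?xs b). \<rho>' x \<in> interp M E" for b
        using \<rho>'(2) \<rho>(2) by (cases b) (simp_all add: eq)
      then show "sem M w \<rho>' = (\<Sum>\<pi>\<in>?P. scl M (\<Prod>x\<leftarrow>?xs True. ?\<xi> \<pi> x (\<rho>' x))
          (scl M (\<Prod>x\<leftarrow>?xs False. ?\<xi> \<pi> x (\<rho> x)) (?u \<pi>)))"
        by (simp add: word eq cong: map_cong)
    qed (auto simp: set_occurrences)
    then show ?thesis
      by (simp add: mult.commute)
  qed
  have outer: "sem M (collect E 0 (?xs False) (collect E 1 (?xs True) w)) (\<rho>(0 := x, 1 := y)) =
      (\<Sum>\<pi>\<in>?P. scl M (?c False \<pi> x) (scl M (?c True \<pi> y) (?u \<pi>)))"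
    if xy: "x \<in> interp M (Bang E)" "y \<in> interp M (Bang E)" for x y \<rho>
  proof -
    define v where "v = (\<lambda>\<pi>. scl M (?c True \<pi> y) (?u \<pi>))"
    have "sem M (collect E 0 (?xs False) (collect E 1 (?xs True) w)) (\<rho>(0 := x, 1 := y)) =
      (\<Sum>\<pi>\<in>?P. scl M (?c False \<pi> ((\<rho>(0 := x, 1 := y)) 0)) (v \<pi>))"
      unfolding \<phi>_def
    proof (rule sem_collect[where \<phi> = ?\<xi> and \<rho> = "\<rho>(0 := x, 1 := y)" and z = 0 and v = v,
          OF ambient coalgebra derel distinct_occurrences _ _ \<xi>[of _ _ False]])
      fix \<rho>'
      assume \<rho>': "\<forall>u. u \<notin> insert 0 (set (?xs False)) \<longrightarrow> \<rho>' u = (\<rho>(0 := x, 1 := y)) u"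
        "\<forall>u\<in>set (?xs False). \<rho>' u \<in> interp M E"
      \<comment> \<open>Letters have names from 4 on, so collecting the zeros leaves the second
        argument alone.\<close>
      have "\<rho>' 1 = y"
        using \<rho>'(1)[rule_format, of 1] by (simp add: set_occurrences image_iff)
      then show "sem M (collect E 1 (?xs True) w) \<rho>' =
          (\<Sum>\<pi>\<in>?P. scl M (\<Prod>x\<leftarrow>?xs False. ?\<xi> \<pi> x (\<rho>' x)) (v \<pi>))"
        unfolding v_def using inner[OF _ \<rho>'(2)] xy(2) by simp
    qed (use xy in \<open>auto simp: set_occurrences\<close>)
    then show ?thesis
      by (simp add: v_def)
  qed
  let ?g = "\<lambda>\<pi>. lam M (Bang E) E (\<lambda>y. scl M (?c True \<pi> y) (?u \<pi>))"
  have g: "?g \<pi> \<in> interp M (Lolli (Bang E) E)" if "\<pi> \<in> ?P" for \<pi>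
    by (rule lam_rank_one(1)[OF ambient subspaces[OF formulas(2)] hom(2) c[OF that] u[OF that]])
  have lam_y: "lam M (Bang E) E (\<lambda>y. sem M (collect E 0 (?xs False) (collect E 1 (?xs True) w))
      (\<rho>(0 := x, 1 := y))) = (\<Sum>\<pi>\<in>?P. scl M (?c False \<pi> x) (?g \<pi>))"
    if "x \<in> interp M (Bang E)" for x \<rho>
    using outer[OF that]
    by (intro lam_sum_rank_one(2)[OF ambient subspaces[OF formulas(2)] subspaces[OF formulas(4)] hom(2) c u])
  let ?h = "\<lambda>x. lam M (Bang E) E (\<lambda>y. sem M (collect E 0 (?xs False) (collect E 1 (?xs True) w))
    ((\<lambda>_. 0)(0 := x, 1 := y)))"
  \<comment> \<open>The scalar 1 only brings the sum into the shape of
    \<open>lam_sum_rank_one\<close>.\<close>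
  have f: "f = (\<Sum>\<pi>\<in>?P. scl M 1 (lam M (Bang E) (Lolli (Bang E) E) (\<lambda>x. scl M (?c False \<pi> x) (?g \<pi>))))"
    by (simp add: f_def rank_one_def)
  have h: "?h x = (\<Sum>\<pi>\<in>?P. scl M 1 (scl M (?c False \<pi> x) (?g \<pi>)))" if "x \<in> interp M (Bang E)" for x
    using lam_y[OF that] by simp
  note lam_x = lam_sum_rank_one[where h = ?h and \<phi> = "?c False" and v = ?g and I = ?P and c = "\<lambda>_. 1",
      OF ambient subspaces[OF formulas(4)] subspaces[OF formulas(5), unfolded bint_def]
        hom(3)[unfolded bint_def] c g h]
  show "f \<in> interp M (bint A)"
    unfolding f bint_def by (rule lam_x(1))
  have "denotation M (binint A T) = lam M (Bang E) (Lolli (Bang E) E) ?h"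
    by (simp add: denotation_def binint_def Let_def n_def w_def)
  then show "denotation M (binint A T) = f"
    unfolding f using lam_x(2) by (rule trans)
qed

text \<open>Up to reordering of factors, a path leaves two monomials of degree at most
  \<open>L\<close> in at most \<open>(card B)\<^sup>2\<close> functionals, and its two end points.
  The exponent and the leading factor of the bound count these data.\<close>

lemma denotations_in_small_span:
  "\<exists>F. finite F \<and> card F \<le> (card B)\<^sup>2 * (L + 1) ^ (2 * (card B)\<^sup>2) \<and>
    (\<forall>T. length T = L \<longrightarrow> denotation M (binint A T) \<in> span F)"
proof -
  define X where "X = (\<lambda>(b, b'). entry M A B b b' \<circ> derel M E) ` (B \<times> B)"
  define K where "K = {\<mu>. set_mset \<mu> \<subseteq> X \<and> size \<mu> \<le> L}"
  \<comment> \<open>Any enumeration of the multiset will do, by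
    \<open>rank_one_mset\<close>.\<close>
  define list where "list = (\<lambda>\<mu> :: ('v \<Rightarrow> 'k) multiset. SOME fs. mset fs = \<mu>)"
  define F where "F = (\<lambda>((\<mu>, \<nu>), (b, b')). rank_one M E (list \<mu>) (list \<nu>) (matrix_unit M A B b b')) `
    ((K \<times> K) \<times> (B \<times> B))"
  have list: "mset (list \<mu>) = \<mu>" for \<mu>
    unfolding list_def by (rule someI_ex) (rule ex_mset)
  have X: "finite X" "card X \<le> (card B)\<^sup>2"
    using B(1) card_image_le[of "B \<times> B" "\<lambda>(b, b'). entry M A B b b' \<circ> derel M E"]
    by (simp_all add: X_def card_cartesian_product power2_eq_square)
  have K: "finite K" "card K \<le> (L + 1) ^ card X"
    unfolding K_def using multisets_size_le[OF X(1)] by auto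
  have F: "finite F"
    using K(1) B(1) by (simp add: F_def)
  have "card F \<le> (card K * card K) * (card B * card B)"
    unfolding F_def using K(1) B(1)
    by (intro order_trans[OF card_image_le]) (simp_all add: card_cartesian_product)
  \<comment> \<open>Different pairs of basis vectors might give the same functional, so
    \<open>card X\<close> is only bounded by \<open>(card B)\<^sup>2\<close>; the base
    \<open>L + 1\<close> is at least 1.\<close>
  also have "\<dots> \<le> ((L + 1) ^ (card B)\<^sup>2 * (L + 1) ^ (card B)\<^sup>2) * (card B * card B)"
    using order_trans[OF K(2) power_increasing[OF X(2)]] by (intro mult_mono) auto
  also have "\<dots> = (card B)\<^sup>2 * (L + 1) ^ (2 * (card B)\<^sup>2)"
    by (simp only: power_add[symmetric] mult_2 power2_eq_square mult.commute)
  finally have card: "card F \<le> (card B)\<^sup>2 * (L + 1) ^ (2 * (card B)\<^sup>2)" .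
  have "denotation M (binint A T) \<in> span F" if T: "length T = L" for T
    unfolding denotation_binint(1)
  proof (rule span_sum)
    fix \<pi>
    assume \<pi>: "\<pi> \<in> {..length T} \<rightarrow>\<^sub>E B"
    let ?fs = "\<lambda>b. map (\<lambda>x. entry M A B (\<pi> (x - 4)) (\<pi> (x - 3)) \<circ> derel M E) (occurrences b T)"
    have "entry M A B (\<pi> k) (\<pi> (Suc k)) \<circ> derel M E \<in> X" if "k < length T" for k
      unfolding X_def using \<pi> that by (intro image_eqI[of _ _ "(\<pi> k, \<pi> (Suc k))"]) auto
    then have X: "set (?fs b) \<subseteq> X" for b
      by (auto simp: set_occurrences)
    have "length (?fs b) \<le> L" for b
      unfolding T[symmetric] occurrences_def length_map by (rule order_trans[OF length_filter_le]) simp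
    with X have K: "mset (?fs b) \<in> K" for b
      by (simp add: K_def)
    have lin: "linear_on (scl M) (interp M (Bang E)) (*) UNIV f" if "f \<in> X" for f
      using that by (auto simp: X_def intro: linear_on_comp[OF derel] entry_linear)
    have "rank_one M E (?fs False) (?fs True) (matrix_unit M A B (\<pi> 0) (\<pi> (length T))) =
        rank_one M E (list (mset (?fs False))) (list (mset (?fs True))) (matrix_unit M A B (\<pi> 0) (\<pi> (length T)))"
    proof (rule rank_one_mset[OF coalgebra])
      fix f
      assume "f \<in> set (?fs False) \<union> set (?fs True)"
      with X show "linear_on (scl M) (interp M (Bang E)) (*) UNIV f"
        by (intro lin) blast
    qed (simp_all only: list)
    also have "\<dots> \<in> F"
      unfolding F_def using K[of False] K[of True] \<pi>
      by (intro image_eqI[of _ _ "((mset (?fs False), mset (?fs True)), (\<pi> 0, \<pi> (length T)))"]) auto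
    finally show "rank_one M E (?fs False) (?fs True) (matrix_unit M A B (\<pi> 0) (\<pi> (length T))) \<in> span F"
      by (rule span_base)
  qed
  with F card show ?thesis
    by blast
qed

end

end

section \<open>More words of one length than dimensions\<close>

theorem propositionB10:
  fixes M :: "('k::{alg_closed_field, field_char_0}, 'v::ab_group_add, 'a) model"
    and S :: "'a form set"
    and A :: "'a form"
  assumes "sweedler_semantics M S"
    and "bint A \<in> S"
    and "finite_dim (scl M) (interp M A)"
  shows "\<exists>Ts :: bool list list. distinct Ts \<and>
    lin_dependent_in (scl M) (interp M (bint A)) (map (\<lambda>T. denotation M (binint A T)) Ts)"
proof -
  interpret sweedler_semantics M S by fact
  interpret vector_space "scl M" by (rule ambient)
  obtain B0 where B0: "finite B0" "span B0 = interp M A"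
    using assms(3) by (auto simp: finite_dim_def)
  \<comment> \<open>The finite spanning set \<open>B0\<close> need not be independent; it serves to
    bound the size of a basis \<open>B\<close>.\<close>
  obtain B where B: "B \<subseteq> interp M A" "independent B" "interp M A \<subseteq> span B"
    using maximal_independent_subset by blast
  have "finite B"
    using independent_span_bound[OF B0(1) B(2)] B(1) B0(2) by simp
  moreover have "span B = interp M A"
    using B(1,3) B0(2) by (metis span_minimal subspace_span subset_antisym)
  ultimately have basis: "finite B" "independent B" "span B = interp M A"
    using B(2) by auto
  note den = denotation_binint[OF assms(2) basis]
  obtain L where L: "(card B)\<^sup>2 * (L + 1) ^ (2 * (card B)\<^sup>2) < 2 ^ L"
    using polynomial_less_power_of_two by blast
  let ?I = "{T :: bool list. length T = L}"
  let ?v = "\<lambda>T. denotation M (binint A T)"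
  have I: "finite ?I" "card ?I = 2 ^ L"
    using finite_lists_length_eq[of "UNIV :: bool set" L] card_lists_length_eq[of "UNIV :: bool set" L]
    by simp_all
  obtain F where "finite F" "card F \<le> (card B)\<^sup>2 * (L + 1) ^ (2 * (card B)\<^sup>2)" "?v ` ?I \<subseteq> span F"
    using denotations_in_small_span[OF assms(2) basis, of L] by blast
  with L have F: "finite F" "card F < card ?I" "?v ` ?I \<subseteq> span F"
    by (simp_all add: I(2))
  obtain c where c: "\<exists>T\<in>?I. c T \<noteq> 0" "(\<Sum>T\<in>?I. scl M (c T) (?v T)) = 0"
    using nontrivial_relation[OF I(1) F] by blast
  \<comment> \<open>The family consists of all words of length \<open>L\<close>, each listed once,
    so that a relation indexed by words becomes one indexed by positions.\<close>
  obtain Ts where Ts: "set Ts = ?I" "distinct Ts"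
    using finite_distinct_list[OF I(1)] by blast
  have "?v T \<in> interp M (bint A)" for T
    unfolding den(1) by (rule den(2))
  moreover have "\<exists>i<length Ts. c (Ts ! i) \<noteq> 0"
    using c(1) unfolding Ts(1)[symmetric] by (metis in_set_conv_nth)
  moreover have "(\<Sum>i<length Ts. scl M (c (Ts ! i)) (?v (Ts ! i))) = (\<Sum>T\<in>?I. scl M (c T) (?v T))"
    using sum.reindex_bij_betw[OF bij_betw_nth[OF Ts(2) refl Ts(1)[symmetric]], of "\<lambda>T. scl M (c T) (?v T)"]
    by simp
  ultimately have "lin_dependent_in (scl M) (interp M (bint A)) (map ?v Ts)"
    using c(2) by (auto simp: lin_dependent_in_def intro!: exI[of _ "\<lambda>i. c (Ts ! i)"])
  with Ts(2) show ?thesis by blast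
qed

end
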